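(* There is an absolute constant $c_0$ such that for every constant $c \ge c_0$ the following holds. In the $p$-processor cup game on $n$ cups against an oblivious filler, if the emptier follows the smoothed greedy algorithm, then with probability at least $1 - \exp(-\log^c n)$, the backlog after each of the first $\exp(\log^c n)$ steps is at most $O(\log p + c\log\log n)$ (with an absolute hidden constant).
   Context: The $p$-processor cup game on $n$ cups: there are $n$ cups, each holding a nonnegative real amount of water (its fill), all initially empty. In each step, the filler first distributes up to $p$ units of water among the cups, placing at most $1$ unit into any single cup; then the emptier selects $p$ cups and removes up to $1$ unit of water from each of them. The backlog is the fill of the fullest cup. An oblivious filler fixes its entire sequence of placements in advance, independently of the emptier's random choices. The smoothed greedy algorithm: before the first step, the emptier chooses independent values $r_1,\dots,r_n$ uniformly at random from $[0,1]$ and inserts $r_j$ units of water into cup $j$; then in each step, after the filler's placement, the emptier removes exactly $1$ unit of water from each of the $p$ fullest cups, except that it does not remove any water from those among the $p$ fullest cups that contain less than $1$ unit of water (ties broken arbitrarily). *)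

theory Defs
  imports "HOL-Probability.Probability"
begin

text \<open>
  Cups are numbered \<open>0, \<dots>, n - 1\<close>; a state assigns to each cup its fill. Values outside
  \<open>{..<n}\<close> are irrelevant. Steps are numbered from 0, so \<open>a t\<close> is the filler's placement in
  the step that leads from the state \<open>w t\<close> (after \<open>t\<close> steps) to \<open>w (Suc t)\<close>.
\<close>

definition legal_placement :: "nat \<Rightarrow> nat \<Rightarrow> (nat \<Rightarrow> real) \<Rightarrow> bool" where
  "legal_placement p n x \<longleftrightarrow>
     (\<forall>j<n. 0 \<le> x j \<and> x j \<le> 1) \<and> (\<Sum>j<n. x j) \<le> real p"

text \<open>Obliviousness is expressed by \<open>a\<close> not depending on the random offsets.\<close>

definition oblivious_filler :: "nat \<Rightarrow> nat \<Rightarrow> (nat \<Rightarrow> nat \<Rightarrow> real) \<Rightarrow> bool" where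
  "oblivious_filler p n a \<longleftrightarrow> (\<forall>t. legal_placement p n (a t))"

definition backlog :: "nat \<Rightarrow> (nat \<Rightarrow> real) \<Rightarrow> real" where
  "backlog n x = Max (x ` {..<n})"

definition fullest_cups :: "nat \<Rightarrow> nat \<Rightarrow> (nat \<Rightarrow> real) \<Rightarrow> nat set \<Rightarrow> bool" where
  "fullest_cups p n x S \<longleftrightarrow>
     S \<subseteq> {..<n} \<and> card S = p \<and> (\<forall>i\<in>S. \<forall>j\<in>{..<n} - S. x j \<le> x i)"

text \<open>
  The emptier's move is a relation between the state \<open>x\<close> after the filler's placement and the
  resulting state \<open>y\<close>: when there are ties, every choice of \<open>p\<close> fullest cups is allowed.
\<close>

definition smoothed_greedy_move :: "nat \<Rightarrow> nat \<Rightarrow> (nat \<Rightarrow> real) \<Rightarrow> (nat \<Rightarrow> real) \<Rightarrow> bool" where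
  "smoothed_greedy_move p n x y \<longleftrightarrow>
     (\<exists>S. fullest_cups p n x S \<and>
          (\<forall>j<n. y j = (if j \<in> S \<and> 1 \<le> x j then x j - 1 else x j)))"

definition smoothed_greedy_run ::
    "nat \<Rightarrow> nat \<Rightarrow> (nat \<Rightarrow> nat \<Rightarrow> real) \<Rightarrow> (nat \<Rightarrow> real) \<Rightarrow> (nat \<Rightarrow> nat \<Rightarrow> real) \<Rightarrow> bool" where
  "smoothed_greedy_run p n a r w \<longleftrightarrow>
     (\<forall>j<n. w 0 j = r j) \<and>
     (\<forall>t. smoothed_greedy_move p n (\<lambda>j. w t j + a t j) (w (Suc t)))"

definition random_offsets :: "nat \<Rightarrow> (nat \<Rightarrow> real) measure" where
  "random_offsets n = PiM {..<n} (\<lambda>_. uniform_measure lborel {0..1})"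

end

theory Submission
  imports Defs
begin

text \<open>
  Because of the random offsets, the number of integer thresholds that a cup crosses in a time
  interval is a rounding of the amount of water placed into it, and these roundings are
  independent over the cups. Fix a level \<open>l\<close> and consider the last step in which fewer than
  \<open>p\<close> cups reached level \<open>l + 1\<close>. Since then all removals took place above \<open>l\<close>, whereas the first
  crossing of every cup below \<open>l\<close> was harmless; so concentration shows that if always at most \<open>B\<close>
  cups have fill \<open>l\<close>, then the total water above level \<open>l\<close> is about \<open>sqrt (B L)\<close>, up to terms
  polynomial in \<open>p\<close> and \<open>L = ln n powr c\<close>. Iterating over \<open>O(ln (ln n))\<close> levels, at most
  \<open>O(p L)\<close> units of water lie above such a level.

  What remains is deterministic. Greedy emptying keeps the total fill of every set of \<open>k\<close> cups below
  a fixed concave function of \<open>k\<close> whose slopes decrease harmonically on both sides of \<open>k = p\<close>,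
  provided that this is known for the sets with just over \<open>M\<close> cups; this bounds the backlog by
  \<open>O(ln (M + p))\<close> above the level. With \<open>M = n\<close> the proviso is vacuous, which gives the a priori
  bound \<open>O(ln n)\<close> on all fills that the first part needs.
\<close>

subsection \<open>Sums of harmonic numbers\<close>

definition harm_sum :: "nat \<Rightarrow> real" where
  "harm_sum n = (\<Sum>s\<le>n. harm s)"

lemma harm_sum_0 [simp]: "harm_sum 0 = 0"
  by (simp add: harm_sum_def harm_def)

lemma harm_sum_Suc [simp]: "harm_sum (Suc n) = harm_sum n + harm (Suc n)"
  by (simp add: harm_sum_def)

lemma harm_sum_eq: "harm_sum n = (real n + 1) * harm n - real n"
proof (induction n)
  case 0
  show ?case by (simp add: harm_def)
next
  case (Suc n)
  have "harm (Suc n) = harm n + 1 / (real n + 1)"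
    by (simp add: harm_Suc divide_inverse add.commute)
  moreover have "(real n + 2) * (harm n + 1 / (real n + 1)) - (real n + 1)
      = (real n + 1) * harm n - real n + (harm n + 1 / (real n + 1))"
    by (simp add: divide_simps) (simp add: algebra_simps)
  ultimately show ?case using Suc by (simp add: add.commute)
qed

lemma harm_ge_1: "1 \<le> n \<Longrightarrow> 1 \<le> (harm n :: real)"
  using harm_mono[of 1 n, where 'a = real] by (simp add: harm_def)

lemma harm_sum_diff_lower: "real i * harm d \<le> harm_sum (d + i) - harm_sum d"
proof (induction i)
  case (Suc i)
  have "harm d \<le> (harm (Suc (d + i)) :: real)" by (rule harm_mono) simp
  then show ?case using Suc by (simp add: algebra_simps)
qed simp

lemma harm_sum_mono: "m \<le> n \<Longrightarrow> harm_sum m \<le> harm_sum n"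
  unfolding harm_sum_def by (intro sum_mono2) (auto simp: harm_nonneg)

lemma harm_sum_ge: "real n \<le> harm_sum n"
proof (induction n)
  case (Suc n)
  then show ?case using harm_ge_1[of "Suc n"] by simp
qed simp

lemma harm_sum_le: "n \<le> N \<Longrightarrow> harm_sum n \<le> real n * harm N"
proof (induction n)
  case (Suc n)
  have "harm (Suc n) \<le> (harm N :: real)" by (rule harm_mono) (use Suc in simp)
  then show ?case using Suc by (simp add: algebra_simps)
qed simp

text \<open>With \<open>d = q - i\<close>, each of the \<open>i\<close> terms in
  \<open>harm_sum q - harm_sum d\<close> is at least \<open>harm d\<close>. Inserting the closed
  form of \<open>harm_sum d\<close> and \<open>harm_sum i \<ge> i\<close> leaves only the
  nonnegative surplus \<open>(i - 1) * harm d\<close>.\<close>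

lemma harm_sum_balance:
  assumes "i \<le> q"
  shows "real q * real i
    \<le> real q * (harm_sum q - harm_sum (q - i)) + real i * (harm_sum i - harm_sum (q - i))"
proof (cases "i = 0")
  case False
  define d where "d = q - i"
  have q: "q = d + i" using assms by (simp add: d_def)
  have "0 \<le> (real i - 1) * harm d" using False by (intro mult_nonneg_nonneg) (auto simp: harm_nonneg)
  then have "real q \<le> real q * harm d + (harm_sum i - harm_sum d)"
    using harm_sum_ge[of i] by (simp add: q harm_sum_eq[of d] algebra_simps)
  then have "real i * real q \<le> real i * (real q * harm d + (harm_sum i - harm_sum d))"
    by (intro mult_left_mono) auto
  moreover have "real q * (real i * harm d) \<le> real q * (harm_sum q - harm_sum d)"
    unfolding q by (intro mult_left_mono harm_sum_diff_lower) auto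
  ultimately show ?thesis by (simp add: d_def algebra_simps)
qed simp

lemma harm_le_ln: "1 \<le> n \<Longrightarrow> harm n \<le> 1 + ln (real n)"
proof (induction n rule: nat_induct_at_least)
  case base
  show ?case by (simp add: harm_def)
next
  case (Suc n)
  have "1 - real n / real (Suc n) \<le> - ln (real n / real (Suc n))"
    using ln_le_minus_one[of "real n / real (Suc n)"] Suc by simp
  also have "\<dots> = ln (real (Suc n)) - ln (real n)" using Suc by (simp add: ln_div)
  also have "1 - real n / real (Suc n) = inverse (real (Suc n))" by (simp add: field_simps)
  finally show ?case using Suc by (simp add: harm_Suc)
qed

section \<open>A concave profile with harmonic slopes\<close>

text \<open>
  The slopes of this concave function are \<open>\<beta> + H\<^bsub>p\<^esub>, \<dots>, \<beta> + H\<^bsub>1\<^esub>, \<beta> - H\<^bsub>1\<^esub>, \<beta> - H\<^bsub>2\<^esub>, \<dots>\<close>.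
  (One of the two truncated differences is always 0.)
\<close>

definition profile :: "nat \<Rightarrow> real \<Rightarrow> nat \<Rightarrow> real" where
  "profile p \<beta> k = real k * \<beta> + harm_sum p - harm_sum ((p - k) + (k - p))"

text \<open>The point \<open>m\<close> lies \<open>q\<close> below the kink at \<open>p\<close> and
  the point \<open>p + i\<close> lies \<open>i\<close> above it, so the harmonic sums at the two
  ends are \<open>harm_sum q\<close> and \<open>harm_sum i\<close>, and
  \<open>harm_sum_balance\<close> applies with the smaller of \<open>q\<close> and \<open>i\<close>
  in the role of \<open>i\<close>. The gap of 1 between the mean slopes pays for the unit that an
  emptied cup loses.\<close>

lemma profile_slopes:
  assumes "0 < q" "0 < i" "p = m + q"
  shows "(profile p \<beta> (p + i) - profile p \<beta> (m + i)) / real q + 1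
    \<le> (profile p \<beta> (m + i) - profile p \<beta> m) / real i"
proof -
  define D where "D = harm_sum ((p - (m + i)) + (m + i - p))"
  have "real q * real i \<le> real q * (harm_sum q - D) + real i * (harm_sum i - D)"
  proof (cases "i \<le> q")
    case True
    then show ?thesis using harm_sum_balance[of i q] by (simp add: D_def assms(3))
  next
    case False
    then show ?thesis using harm_sum_balance[of q i] by (simp add: D_def assms(3) algebra_simps)
  qed
  moreover have "(D - y) / q + 1 \<le> (x - D) / i"
    if "q * i \<le> q * (x - D) + i * (y - D)" "0 < q" "0 < i" for x y i q :: real
    using that by (simp add: divide_simps) (simp add: algebra_simps)
  ultimately have "(D - harm_sum i) / real q + 1 \<le> (harm_sum q - D) / real i"
    using assms(1,2) by simp
  moreover have "profile p \<beta> (p + i) - profile p \<beta> (m + i) = real q * \<beta> + (D - harm_sum i)"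
    "profile p \<beta> (m + i) - profile p \<beta> m = real i * \<beta> + (harm_sum q - D)"
    by (simp_all add: profile_def D_def assms(3) algebra_simps)
  ultimately show ?thesis using assms(1,2) by (simp add: add_divide_distrib)
qed

text \<open>Each of the first \<open>K\<close> slopes is at least
  \<open>\<beta> - harm K\<close>.\<close>

lemma profile_ge:
  assumes "k \<le> K"
  shows "real k * (\<beta> - harm K) \<le> profile p \<beta> k"
proof (cases "k \<le> p")
  case True
  then have "harm_sum (p - k) \<le> harm_sum p" by (intro harm_sum_mono) simp
  moreover have "0 \<le> real k * harm K" by (simp add: harm_nonneg)
  ultimately show ?thesis using True by (simp add: profile_def algebra_simps)
next
  case False
  have "harm_sum (k - p) \<le> real (k - p) * harm K" by (rule harm_sum_le) (use assms in simp)
  also have "\<dots> \<le> real k * harm K" by (intro mult_right_mono) (auto simp: harm_nonneg)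
  moreover have "0 \<le> harm_sum p" using harm_sum_mono[of 0 p] by simp
  ultimately show ?thesis using False by (simp add: profile_def algebra_simps)
qed

lemma profile_diff_ge:
  assumes "m \<le> p" "m \<le> k" "k \<le> K"
  shows "real (k - m) * (\<beta> - harm K) \<le> profile p \<beta> k - profile p \<beta> m"
proof -
  have *: "harm_sum ((p - k) + (k - p)) \<le> harm_sum (p - m) + real (k - m) * harm K"
  proof (cases "k \<le> p")
    case True
    then have "harm_sum (p - k) \<le> harm_sum (p - m)" using assms by (intro harm_sum_mono) simp
    moreover have "0 \<le> real (k - m) * harm K" by (simp add: harm_nonneg)
    ultimately show ?thesis using True by simp
  next
    case False
    have "harm_sum (k - p) \<le> real (k - p) * harm K" by (rule harm_sum_le) (use assms in simp)
    also have "\<dots> \<le> real (k - m) * harm K" using assms by (intro mult_right_mono) (auto simp: harm_nonneg)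
    moreover have "0 \<le> harm_sum (p - m)" using harm_sum_mono[of 0 "p - m"] by simp
    ultimately show ?thesis using False by simp
  qed
  have "real (k - m) = real k - real m" using assms by simp
  then show ?thesis using * assms by (simp add: profile_def algebra_simps)
qed

subsection \<open>Greedy emptying against a fixed placement sequence\<close>

text \<open>A single deterministic run: \<open>S\<close> records how ties are broken, and the
  offsets enter only as start values between 0 and 1.\<close>

locale greedy_run =
  fixes p n :: nat and a w :: "nat \<Rightarrow> nat \<Rightarrow> real" and S :: "nat \<Rightarrow> nat set"
  assumes p_pos: "1 \<le> p"
    and p_le: "p \<le> n"
    and legal: "\<And>t. legal_placement p n (a t)"
    and init: "\<And>j. j < n \<Longrightarrow> 0 \<le> w 0 j \<and> w 0 j \<le> 1"
    and fullest: "\<And>t. fullest_cups p n (\<lambda>j. w t j + a t j) (S t)"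
    and step: "\<And>t j. j < n \<Longrightarrow> w (Suc t) j =
      (if j \<in> S t \<and> 1 \<le> w t j + a t j then w t j + a t j - 1 else w t j + a t j)"
begin

definition filled :: "nat \<Rightarrow> nat \<Rightarrow> real" where
  "filled t j = w t j + a t j"

definition emptied :: "nat \<Rightarrow> nat set" where
  "emptied t = {j \<in> S t. 1 \<le> filled t j}"

lemma a_nonneg: "j < n \<Longrightarrow> 0 \<le> a t j" and a_le_1: "j < n \<Longrightarrow> a t j \<le> 1"
  and a_sum: "(\<Sum>j<n. a t j) \<le> real p"
  using legal[of t] by (auto simp: legal_placement_def)

lemma S_subset: "S t \<subseteq> {..<n}" and card_S: "card (S t) = p" and finite_S: "finite (S t)"
  using fullest[of t] by (auto simp: fullest_cups_def intro: finite_subset)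

lemma S_max: "i \<in> S t \<Longrightarrow> j < n \<Longrightarrow> j \<notin> S t \<Longrightarrow> filled t j \<le> filled t i"
  using fullest[of t] by (auto simp: fullest_cups_def filled_def)

lemma emptied_subset: "emptied t \<subseteq> S t"
  by (auto simp: emptied_def)

lemma w_Suc_emptied: "j \<in> emptied t \<Longrightarrow> w (Suc t) j = filled t j - 1"
  using S_subset[of t] by (auto simp: emptied_def filled_def step)

lemma w_Suc_not_emptied: "j < n \<Longrightarrow> j \<notin> emptied t \<Longrightarrow> w (Suc t) j = filled t j"
  by (auto simp: emptied_def filled_def step)

lemma sum_a_subset: "A \<subseteq> {..<n} \<Longrightarrow> (\<Sum>j\<in>A. a t j) \<le> real p"
  using sum_mono2[of "{..<n}" A "a t"] a_nonneg[of _ t] a_sum[of t] by force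

text \<open>Fewer than \<open>p\<close> removals mean that some selected cup holds less than 1 unit,
  and no unselected cup is fuller than that one.\<close>

lemma not_emptied_less_1:
  assumes "card (emptied t) < p" "j < n" "j \<notin> emptied t"
  shows "filled t j < 1"
proof -
  have "emptied t \<noteq> S t" using assms(1) card_S[of t] by auto
  then obtain i where i: "i \<in> S t" "i \<notin> emptied t" using emptied_subset[of t] by auto
  then have *: "filled t i < 1" by (simp add: emptied_def)
  show ?thesis
  proof (cases "j \<in> S t")
    case True
    then show ?thesis using assms(3) by (simp add: emptied_def)
  next
    case False
    then show ?thesis using S_max[OF i(1) assms(2)] * by simp
  qed
qed

text \<open>
  If the \<open>q\<close> emptied cups outside \<open>A\<close> are added to \<open>A\<close>, then nothing is gained on the whole set,
  while these \<open>q\<close> cups are, up to 1, as full as the fullest cup of \<open>A\<close> that was not emptied. So a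
  high fill of \<open>A\<close> after the step entails a high fill of a larger set before the step.
\<close>

lemma sum_le_profile_step:
  assumes \<beta>: "1 + harm K \<le> \<beta>" and A: "A \<subseteq> {..<n}" "card A + p \<le> K"
    and prev: "\<And>T. T \<subseteq> {..<n} \<Longrightarrow> card T \<le> K \<Longrightarrow> (\<Sum>j\<in>T. w t j) \<le> profile p \<beta> (card T)"
    and smaller: "\<And>T. T \<subseteq> {..<n} \<Longrightarrow> card T < card A \<Longrightarrow> (\<Sum>j\<in>T. w (Suc t) j) \<le> profile p \<beta> (card T)"
  shows "(\<Sum>j\<in>A. w (Suc t) j) \<le> profile p \<beta> (card A)"
proof -
  define E where "E = emptied t"
  have En: "E \<subseteq> {..<n}" using emptied_subset[of t] S_subset[of t] by (auto simp: E_def)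
  have fin: "finite A" "finite E" using A En by (auto intro: finite_subset)
  have cardE: "card E \<le> p"
    using card_mono[OF finite_S emptied_subset[of t]] card_S[of t] by (simp add: E_def)
  have shrink: "w (Suc t) j \<le> w t j" if "j \<in> E" for j
    using that a_le_1[of j t] En w_Suc_emptied[of j t] by (auto simp: E_def filled_def)
  have split: "(\<Sum>j\<in>A. f j) = (\<Sum>j\<in>A \<inter> E. f j) + (\<Sum>j\<in>A - E. f j)" for f :: "nat \<Rightarrow> real"
    using sum.Int_Diff[OF fin(1)] .
  have card_split: "card A = card (A \<inter> E) + card (A - E)"
    using card_Int_Diff[OF fin(1)] .
  \<comment> \<open>Emptied cups never gain water. If fewer than \<open>p\<close> cups are emptied,
    all others hold less than 1; if all \<open>p\<close> emptied cups lie in \<open>A\<close>, then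
    \<open>A\<close> loses at least what is placed into it. The last case needs the concavity of the
    profile.\<close>
  consider "A \<subseteq> E" | "card E < p" "\<not> A \<subseteq> E" | "card E = p" "\<not> A \<subseteq> E" "E \<subseteq> A"
    | "card E = p" "\<not> A \<subseteq> E" "\<not> E \<subseteq> A" using cardE by linarith
  then show ?thesis
  proof cases
    case 1
    then have "(\<Sum>j\<in>A. w (Suc t) j) \<le> (\<Sum>j\<in>A. w t j)" by (intro sum_mono shrink) auto
    also have "\<dots> \<le> profile p \<beta> (card A)" using A by (intro prev) auto
    finally show ?thesis .
  next
    case 2
    have m: "card (A \<inter> E) < p" using 2(1) card_mono[OF fin(2), of "A \<inter> E"] by simp
    have "(\<Sum>j\<in>A \<inter> E. w (Suc t) j) \<le> (\<Sum>j\<in>A \<inter> E. w t j)" by (intro sum_mono shrink) auto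
    also have "\<dots> \<le> profile p \<beta> (card (A \<inter> E))" using A card_split by (intro prev) auto
    finally have 1: "(\<Sum>j\<in>A \<inter> E. w (Suc t) j) \<le> profile p \<beta> (card (A \<inter> E))" .
    have "(\<Sum>j\<in>A - E. w (Suc t) j) \<le> real (card (A - E)) * 1"
    proof (rule sum_bounded_above)
      fix j assume "j \<in> A - E"
      then show "w (Suc t) j \<le> 1"
        using not_emptied_less_1[of t j] w_Suc_not_emptied[of j t] 2(1) A by (auto simp: E_def)
    qed
    also have "\<dots> \<le> real (card (A - E)) * (\<beta> - harm K)" using \<beta> by (intro mult_left_mono) auto
    also have "card (A - E) = card A - card (A \<inter> E)" using card_split by simp
    also have "real (card A - card (A \<inter> E)) * (\<beta> - harm K) \<le> profile p \<beta> (card A) - profile p \<beta> (card (A \<inter> E))"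
      using m card_split A by (intro profile_diff_ge) auto
    finally show ?thesis using 1 by (simp add: split)
  next
    case 3
    have "(\<Sum>j\<in>A. w (Suc t) j) = (\<Sum>j\<in>A. filled t j - of_bool (j \<in> E))"
      using A w_Suc_emptied[of _ t] w_Suc_not_emptied[of _ t] by (intro sum.cong) (auto simp: E_def)
    also have "\<dots> = (\<Sum>j\<in>A. w t j) + (\<Sum>j\<in>A. a t j) - real (card (A \<inter> E))"
      using fin by (simp add: sum_subtractf filled_def sum.distrib Int_def)
    also have "A \<inter> E = E" using 3 by auto
    finally have "(\<Sum>j\<in>A. w (Suc t) j) \<le> (\<Sum>j\<in>A. w t j)" using sum_a_subset[OF A(1), of t] 3 by simp
    also have "\<dots> \<le> profile p \<beta> (card A)" using A by (intro prev) auto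
    finally show ?thesis .
  next
    case 4
    define F where "F = (\<Sum>j\<in>A. w (Suc t) j)"
    define v where "v = Max (w (Suc t) ` (A - E))"
    define m i q where "m = card (A \<inter> E)" and "i = card (A - E)" and "q = card (E - A)"
    have ne: "A - E \<noteq> {}" using 4 by auto
    then have i: "0 < i" using fin by (simp add: i_def card_gt_0_iff)
    have q: "0 < q" using 4 fin by (auto simp add: q_def card_gt_0_iff)
    have pmq: "p = m + q" using card_Int_Diff[OF fin(2), of A] 4 by (simp add: m_def q_def Int_commute)
    have k: "card A = m + i" using card_split by (simp add: m_def i_def)
    have "v \<in> w (Suc t) ` (A - E)" unfolding v_def using ne fin by (intro Max_in) auto
    then obtain j0 where j0: "j0 \<in> A - E" "v = w (Suc t) j0" by auto
    have v_le: "w (Suc t) j \<le> v" if "j \<in> A - E" for j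
      unfolding v_def using that fin by (intro Max_ge) auto
    have S: "S t = E" using 4 card_S[of t] card_subset_eq[OF finite_S emptied_subset[of t]]
      by (simp add: E_def)
    have high: "v - 1 \<le> w (Suc t) j" if "j \<in> E - A" for j
      using S_max[of j t j0] j0 that A S w_Suc_emptied[of j t] w_Suc_not_emptied[of j0 t]
      by (auto simp: E_def)
    have "(\<Sum>j\<in>A \<union> E. w (Suc t) j) = (\<Sum>j\<in>A \<union> E. filled t j - of_bool (j \<in> E))"
      using A En w_Suc_emptied[of _ t] w_Suc_not_emptied[of _ t] by (intro sum.cong) (auto simp: E_def)
    also have "\<dots> = (\<Sum>j\<in>A \<union> E. w t j) + (\<Sum>j\<in>A \<union> E. a t j) - real (card ((A \<union> E) \<inter> E))"
      using fin by (simp add: sum_subtractf filled_def sum.distrib Int_def)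
    also have "(A \<union> E) \<inter> E = E" by auto
    finally have "(\<Sum>j\<in>A \<union> E. w (Suc t) j) \<le> (\<Sum>j\<in>A \<union> E. w t j)"
      using sum_a_subset[of "A \<union> E" t] A En 4 by simp
    also have "\<dots> \<le> profile p \<beta> (card (A \<union> E))"
      using A En cardE card_Un_le[of A E] by (intro prev) auto
    also have "A \<union> E = A \<union> (E - A)" by auto
    also have "card (A \<union> (E - A)) = p + i"
      using fin card_Un_disjoint[of A "E - A"] by (simp add: k pmq q_def)
    also have "(\<Sum>j\<in>A \<union> (E - A). w (Suc t) j) = F + (\<Sum>j\<in>E - A. w (Suc t) j)"
      unfolding F_def using fin by (intro sum.union_disjoint) auto
    finally have up: "F + (\<Sum>j\<in>E - A. w (Suc t) j) \<le> profile p \<beta> (p + i)" .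
    have "real q * (v - 1) \<le> (\<Sum>j\<in>E - A. w (Suc t) j)"
      unfolding q_def using high by (intro sum_bounded_below) auto
    with up have up: "F + real q * (v - 1) \<le> profile p \<beta> (p + i)" by simp
    have "(\<Sum>j\<in>A - E. w (Suc t) j) \<le> real i * v"
      unfolding i_def using v_le by (intro sum_bounded_above) auto
    moreover have "(\<Sum>j\<in>A \<inter> E. w (Suc t) j) \<le> profile p \<beta> m"
      unfolding m_def using A i k by (intro smaller) (auto simp: m_def)
    ultimately have low: "F \<le> profile p \<beta> m + real i * v" by (simp add: F_def split)
    \<comment> \<open>Otherwise \<open>A - E\<close> would have a mean fill, and hence a maximum
      \<open>v\<close>, above the mean slope from \<open>m\<close> to \<open>m + i\<close>. By
      \<open>profile_slopes\<close>, the \<open>q\<close> further cups, holding at least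
      \<open>v - 1\<close> each, would then lift \<open>A \<union> E\<close> above its own
      bound.\<close>
    have "F \<le> profile p \<beta> (m + i)"
    proof (rule ccontr)
      assume neg: "\<not> F \<le> profile p \<beta> (m + i)"
      then have "(profile p \<beta> (m + i) - profile p \<beta> m) / real i < v"
        using low i by (simp add: field_simps)
      with profile_slopes[OF q i pmq, of \<beta>]
      have "(profile p \<beta> (p + i) - profile p \<beta> (m + i)) / real q < v - 1" by simp
      then have "profile p \<beta> (p + i) - profile p \<beta> (m + i) < real q * (v - 1)"
        using q by (simp add: field_simps)
      then show False using up neg by simp
    qed
    then show ?thesis by (simp add: F_def k)
  qed
qed

text \<open>Induction over the steps and, within a step, over the size of the set. Going back one
  step enlarges a set by at most \<open>p\<close> cups, which is harmless for sets of at most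
  \<open>M\<close> cups; the sizes from \<open>M + 1\<close> to \<open>M + p\<close> are left to
  \<open>spread\<close>.\<close>

lemma sum_le_profile:
  assumes \<beta>: "1 + harm (M + p) + \<mu> \<le> \<beta>" and mu: "0 \<le> \<mu>"
    and spread: "\<And>s T. s \<le> t \<Longrightarrow> T \<subseteq> {..<n} \<Longrightarrow> M < card T \<Longrightarrow> card T \<le> M + p \<Longrightarrow>
      (\<Sum>j\<in>T. w s j) \<le> real (card T) * \<mu> + real M"
    and "s \<le> t" "T \<subseteq> {..<n}" "card T \<le> M + p"
  shows "(\<Sum>j\<in>T. w s j) \<le> profile p \<beta> (card T)"
  using assms(4-)
proof (induction s arbitrary: T)
  case 0
  have "(\<Sum>j\<in>T. w 0 j) \<le> real (card T) * 1"
    using init 0 by (intro sum_bounded_above) auto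
  also have "\<dots> \<le> real (card T) * (\<beta> - harm (M + p))"
    using \<beta> mu by (intro mult_left_mono) auto
  also have "\<dots> \<le> profile p \<beta> (card T)" using 0 by (intro profile_ge) auto
  finally show ?case .
next
  case (Suc s)
  note prev = Suc.IH[OF Suc_leD[OF Suc.prems(1)]]
  show ?case using Suc.prems(2,3)
  proof (induction "card T" arbitrary: T rule: less_induct)
    case less
    show ?case
    proof (cases "card T \<le> M")
      case True
      show ?thesis
      proof (rule sum_le_profile_step[where K = "M + p"])
        show "1 + harm (M + p) \<le> \<beta>" using \<beta> mu by simp
        show "T \<subseteq> {..<n}" by (rule less.prems)
        show "card T + p \<le> M + p" using True by simp
        show "(\<Sum>j\<in>U. w s j) \<le> profile p \<beta> (card U)" if "U \<subseteq> {..<n}" "card U \<le> M + p" for U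
          using that by (rule prev)
        show "(\<Sum>j\<in>U. w (Suc s) j) \<le> profile p \<beta> (card U)" if "U \<subseteq> {..<n}" "card U < card T" for U
          using less.hyps[OF that(2,1)] that(2) True by simp
      qed
    next
      case False
      have "(\<Sum>j\<in>T. w (Suc s) j) \<le> real (card T) * \<mu> + real M"
        using False by (intro spread[OF Suc.prems(1) less.prems(1) _ less.prems(2)]) simp
      \<comment> \<open>As \<open>card T\<close> exceeds \<open>M\<close>, the summand
        \<open>M\<close> costs at most 1 per cup.\<close>
      also have "\<dots> \<le> real (card T) * (1 + \<mu>)" using False by (simp add: distrib_left)
      also have "\<dots> \<le> real (card T) * (\<beta> - harm (M + p))"
        using \<beta> by (intro mult_left_mono) auto
      also have "\<dots> \<le> profile p \<beta> (card T)" by (rule profile_ge[OF less.prems(2)])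
      finally show ?thesis .
    qed
  qed
qed

text \<open>A single cup is a set of size 1, and the first slope of the profile is
  \<open>\<beta> + harm p\<close>.\<close>

lemma fill_le:
  assumes "0 \<le> \<mu>"
    and "\<And>s T. s \<le> t \<Longrightarrow> T \<subseteq> {..<n} \<Longrightarrow> M < card T \<Longrightarrow> card T \<le> M + p \<Longrightarrow>
      (\<Sum>j\<in>T. w s j) \<le> real (card T) * \<mu> + real M"
    and "j < n"
  shows "w t j \<le> \<mu> + 1 + harm (M + p) + harm p"
proof -
  have "(\<Sum>j\<in>{j}. w t j) \<le> profile p (1 + harm (M + p) + \<mu>) (card {j})"
    by (rule sum_le_profile[OF _ assms(1,2), where s = t]) (use assms(3) p_pos in auto)
  moreover have "harm_sum p = harm_sum (p - 1) + harm p"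
    using p_pos harm_sum_Suc[of "p - 1"] by simp
  ultimately show ?thesis using p_pos by (simp add: profile_def)
qed

lemma fill_le_log:
  assumes "j < n"
  shows "w t j \<le> 3 + 2 * ln (2 * real n)"
proof -
  have "w t j \<le> 0 + 1 + harm (n + p) + harm p"
  proof (rule fill_le)
    fix T assume T: "T \<subseteq> {..<n}" "n < card T"
    then show "(\<Sum>j\<in>T. w s j) \<le> real (card T) * 0 + real n" for s
      using card_mono[of "{..<n}" T] by simp
  qed (use assms in auto)
  moreover have "harm (n + p) \<le> (harm (2 * n) :: real)" "harm p \<le> (harm (2 * n) :: real)"
    using p_le by (auto intro!: harm_mono)
  moreover have "harm (2 * n) \<le> 1 + ln (real (2 * n))" using assms by (intro harm_le_ln) auto
  ultimately show ?thesis by simp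
qed

end

subsection \<open>Excess over a level in terms of threshold crossings\<close>

definition placed :: "(nat \<Rightarrow> nat \<Rightarrow> real) \<Rightarrow> nat \<Rightarrow> nat \<Rightarrow> real" where
  "placed a t j = (\<Sum>s<t. a s j)"

definition added :: "(nat \<Rightarrow> nat \<Rightarrow> real) \<Rightarrow> nat \<Rightarrow> nat \<Rightarrow> nat \<Rightarrow> real" where
  "added a s t j = placed a t j - placed a s j"

text \<open>
  Removals are left out: being integral, they do not affect the fractional part of a fill.
\<close>

definition crossings :: "(nat \<Rightarrow> nat \<Rightarrow> real) \<Rightarrow> (nat \<Rightarrow> real) \<Rightarrow> nat \<Rightarrow> nat \<Rightarrow> nat \<Rightarrow> int" where
  "crossings a r s t j = \<lfloor>r j + placed a t j\<rfloor> - \<lfloor>r j + placed a s j\<rfloor>"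

text \<open>For uniform offsets this is the expected number of cups with at least one crossing
  between \<open>s\<close> and \<open>t\<close>; it also bounds the variance of the total number of
  crossings.\<close>

definition reach :: "nat \<Rightarrow> (nat \<Rightarrow> nat \<Rightarrow> real) \<Rightarrow> nat \<Rightarrow> nat \<Rightarrow> real" where
  "reach n a s t = (\<Sum>j<n. min 1 (added a s t j))"

text \<open>The two one-sided estimates that the excess bound uses. The error is that of a Chernoff
  bound before its parameter \<open>\<delta>\<close> is optimised, so \<open>\<delta>\<close> can be
  fixed from a bound on the number of cups without knowing the reach.\<close>

definition concentrated ::
    "nat \<Rightarrow> (nat \<Rightarrow> nat \<Rightarrow> real) \<Rightarrow> real \<Rightarrow> real \<Rightarrow> nat \<Rightarrow> nat \<Rightarrow> (nat \<Rightarrow> real) \<Rightarrow> bool" where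
  "concentrated n a \<delta> L s t r \<longleftrightarrow>
     (\<Sum>j<n. of_int (crossings a r s t j)) \<le> (\<Sum>j<n. added a s t j) + (\<delta> * reach n a s t + L / \<delta>) \<and>
     reach n a s t - (\<delta> * reach n a s t + L / \<delta>) \<le> (\<Sum>j<n. of_int (min 1 (crossings a r s t j)))"

context greedy_run
begin

definition removed :: "nat \<Rightarrow> nat \<Rightarrow> nat \<Rightarrow> int" where
  "removed s t j = (\<Sum>u=s..<t. of_bool (j \<in> emptied u))"

lemma removed_nonneg: "0 \<le> removed s t j"
  by (simp add: removed_def sum_nonneg)

lemma w_eq: "j < n \<Longrightarrow> w t j = w 0 j + placed a t j - of_int (removed 0 t j)"
proof (induction t)
  case (Suc t)
  have "w (Suc t) j = filled t j - of_bool (j \<in> emptied t)"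
    using Suc.prems w_Suc_emptied[of j t] w_Suc_not_emptied[of j t] by auto
  then show ?case using Suc by (simp add: removed_def placed_def filled_def)
qed (simp add: removed_def placed_def)

lemma floor_w_eq:
  assumes "j < n" "s \<le> t"
  shows "\<lfloor>w t j\<rfloor> = \<lfloor>w s j\<rfloor> + crossings a (w 0) s t j - removed s t j"
proof -
  have "removed 0 t j = removed 0 s j + removed s t j"
    unfolding removed_def by (rule sum.atLeastLessThan_concat[symmetric]) (use assms(2) in auto)
  then show ?thesis
    using assms(1) floor_diff_of_int[of _ "removed 0 s j + removed s t j"]
    by (simp add: w_eq[of j t] w_eq[of j s] crossings_def del: of_int_add)
qed

lemma added_nonneg:
  assumes "j < n" "s \<le> t"
  shows "0 \<le> added a s t j"
proof -
  have "(\<Sum>u<s. a u j) \<le> (\<Sum>u<t. a u j)" using assms a_nonneg by (intro sum_mono2) auto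
  then show ?thesis by (simp add: added_def placed_def)
qed

lemma crossings_nonneg:
  assumes "j < n" "s \<le> t"
  shows "0 \<le> crossings a r s t j"
  using added_nonneg[OF assms] by (simp add: crossings_def added_def floor_mono)

lemma sum_added_le:
  assumes "s \<le> t"
  shows "(\<Sum>j<n. added a s t j) \<le> real p * real (t - s)"
proof -
  have "added a s t j = (\<Sum>u=s..<t. a u j)" for j
    using sum.atLeastLessThan_concat[of 0 s t "\<lambda>u. a u j"] assms
    by (simp add: added_def placed_def lessThan_atLeast0)
  then have "(\<Sum>j<n. added a s t j) = (\<Sum>j<n. \<Sum>u=s..<t. a u j)" by simp
  also have "\<dots> = (\<Sum>u=s..<t. \<Sum>j<n. a u j)" by (rule sum.swap)
  also have "\<dots> \<le> real (card {s..<t}) * real p" by (rule sum_bounded_above) (rule a_sum)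
  finally show ?thesis by (simp add: mult.commute)
qed

section \<open>Busy and idle steps\<close>

definition busy :: "nat \<Rightarrow> nat \<Rightarrow> bool" where
  "busy l u \<longleftrightarrow> p \<le> card {j. j < n \<and> real l + 1 \<le> filled u j}"

text \<open>If a selected cup were below \<open>l + 1\<close>, then the cups that reach
  \<open>l + 1\<close> would all be among the other \<open>p - 1\<close> selected ones.\<close>

lemma busy_emptied:
  assumes "busy l u"
  shows "emptied u = S u" and "\<And>j. j \<in> S u \<Longrightarrow> real l + 1 \<le> filled u j"
proof -
  show *: "real l + 1 \<le> filled u j" if "j \<in> S u" for j
  proof (rule ccontr)
    assume neg: "\<not> real l + 1 \<le> filled u j"
    have "{j. j < n \<and> real l + 1 \<le> filled u j} \<subseteq> S u - {j}"
      using neg S_max[OF that] by force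
    then have "card {j. j < n \<and> real l + 1 \<le> filled u j} \<le> card (S u - {j})"
      using finite_S by (intro card_mono) auto
    also have "\<dots> < p" using that finite_S[of u] card_S[of u] p_pos by simp
    finally show False using assms by (simp add: busy_def)
  qed
  show "emptied u = S u" unfolding emptied_def using * by force
qed

text \<open>A removal in a busy step leaves its cup at level \<open>l\<close> or above, and from its
  last removal on the cup only gains water.\<close>

lemma removed_imp_high:
  assumes "s \<le> t" "\<And>u. s \<le> u \<Longrightarrow> u < t \<Longrightarrow> busy l u" "j < n" "removed s t j \<noteq> 0"
  shows "real l \<le> w t j"
  using assms
proof (induction t rule: dec_induct)
  case base
  then show ?case by (simp add: removed_def)
next
  case (step t)
  show ?case
  proof (cases "j \<in> emptied t")
    case True
    then show ?thesis
      using busy_emptied[of l t] step.prems(1)[of t] step.hyps w_Suc_emptied[of j t] by fastforce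
  next
    case False
    then have "removed s (Suc t) j = removed s t j" using step.hyps by (simp add: removed_def)
    then have "real l \<le> w t j" using step by auto
    then show ?thesis
      using False w_Suc_not_emptied[of j t] a_nonneg[of j t] step.prems by (simp add: filled_def)
  qed
qed

lemma sum_removed:
  assumes "\<And>u. s \<le> u \<Longrightarrow> u < t \<Longrightarrow> busy l u"
  shows "(\<Sum>j<n. removed s t j) = int p * int (t - s)"
proof -
  have "(\<Sum>j<n. removed s t j) = (\<Sum>u=s..<t. \<Sum>j<n. of_bool (j \<in> emptied u))"
    unfolding removed_def by (rule sum.swap)
  also have "\<dots> = (\<Sum>u=s..<t. int p)"
  proof (rule sum.cong)
    fix u assume "u \<in> {s..<t}"
    then have "{..<n} \<inter> {j. j \<in> emptied u} = S u" using busy_emptied(1)[of l u] assms S_subset[of u] by auto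
    then show "(\<Sum>j<n. of_bool (j \<in> emptied u)) = int p"
      using card_S[of u] by simp
  qed simp
  finally show ?thesis by simp
qed

text \<open>Whole units above level \<open>l\<close>: floors change only through crossings and
  removals, which can be counted.\<close>

definition excess :: "nat \<Rightarrow> nat \<Rightarrow> int" where
  "excess l t = (\<Sum>j<n. max 0 (\<lfloor>w t j\<rfloor> - int l))"

definition above :: "nat \<Rightarrow> nat \<Rightarrow> nat set" where
  "above l t = {j. j < n \<and> real l \<le> w t j}"

lemma finite_above [simp]: "finite (above l t)"
  by (simp add: above_def)

lemma card_above_le_excess: "int (card (above (Suc l) t)) \<le> excess l t"
proof -
  have "int (card (above (Suc l) t)) = (\<Sum>j\<in>above (Suc l) t. 1)" by simp
  also have "\<dots> \<le> (\<Sum>j\<in>above (Suc l) t. max 0 (\<lfloor>w t j\<rfloor> - int l))"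
  proof (rule sum_mono)
    fix j assume "j \<in> above (Suc l) t"
    then have "int (Suc l) \<le> \<lfloor>w t j\<rfloor>" by (simp add: above_def le_floor_iff)
    then show "1 \<le> max 0 (\<lfloor>w t j\<rfloor> - int l)" by simp
  qed
  also have "\<dots> \<le> excess l t"
    unfolding excess_def by (rule sum_mono2) (auto simp: above_def)
  finally show ?thesis .
qed

text \<open>The busy period up to \<open>t\<close> starts at \<open>s\<close>; it is empty, with
  \<open>s = t\<close>, when the step just before \<open>t\<close> is idle.\<close>

lemma last_idle:
  "\<exists>s\<le>t. (\<forall>u. s \<le> u \<and> u < t \<longrightarrow> busy l u) \<and> (s = 0 \<or> \<not> busy l (s - 1))"
proof (induction t)
  case (Suc t)
  then obtain s where s: "s \<le> t" "\<forall>u. s \<le> u \<and> u < t \<longrightarrow> busy l u" "s = 0 \<or> \<not> busy l (s - 1)" by blast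
  show ?case
  proof (cases "busy l t")
    case True
    then show ?thesis using s by (intro exI[of _ s]) (auto simp: less_Suc_eq)
  next
    case False
    then show ?thesis by (intro exI[of _ "Suc t"]) auto
  qed
qed auto

text \<open>In an idle step fewer than \<open>p\<close> cups reach \<open>l + 1\<close>, and only
  these can contribute afterwards. At time 0 no fill exceeds 1, hence none exceeds
  \<open>l\<close>.\<close>

lemma excess_after_idle:
  assumes "1 \<le> l" "s = 0 \<or> \<not> busy l (s - 1)" "\<And>j. j < n \<Longrightarrow> w s j \<le> H" "0 \<le> H"
  shows "excess l s \<le> real p * H"
proof (cases s)
  case 0
  have "\<lfloor>w 0 j\<rfloor> \<le> int l" if "j < n" for j
    using init[OF that] assms(1) by linarith
  then have "excess l 0 \<le> 0" unfolding excess_def by (intro sum_nonpos) auto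
  moreover have "0 \<le> real p * H" using assms(4) by simp
  ultimately show ?thesis using 0 by (smt (verit) of_int_le_0_iff)
next
  case (Suc u)
  define U where "U = {j. j < n \<and> real l + 1 \<le> filled u j}"
  have U: "card U < p" "finite U" "U \<subseteq> {..<n}" using assms(2) Suc by (auto simp: U_def busy_def)
  have "excess l s = (\<Sum>j\<in>U. max 0 (\<lfloor>w s j\<rfloor> - int l))"
    unfolding excess_def
  proof (rule sum.mono_neutral_right)
    show "\<forall>j\<in>{..<n} - U. max 0 (\<lfloor>w s j\<rfloor> - int l) = 0"
    proof
      fix j assume j: "j \<in> {..<n} - U"
      then have "w s j < real l + 1"
        using w_Suc_emptied[of j u] w_Suc_not_emptied[of j u] Suc
        by (cases "j \<in> emptied u") (auto simp: U_def)
      then show "max 0 (\<lfloor>w s j\<rfloor> - int l) = 0" by linarith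
    qed
  qed (use U in auto)
  then have "excess l s = (\<Sum>j\<in>U. real_of_int (max 0 (\<lfloor>w s j\<rfloor> - int l)))" by simp
  also have "\<dots> \<le> real (card U) * H"
  proof (rule sum_bounded_above)
    fix j assume "j \<in> U"
    then have "w s j \<le> H" using assms(3) by (simp add: U_def)
    then show "real_of_int (max 0 (\<lfloor>w s j\<rfloor> - int l)) \<le> H" using assms(4)
      by (simp add: max_def) linarith
  qed
  also have "\<dots> \<le> real p * H" using U assms(4) by (intro mult_right_mono) auto
  finally show ?thesis .
qed

text \<open>
  During a busy period every removal is from above level \<open>l\<close>, whereas the first crossing of a
  cup that starts below \<open>l\<close> does not contribute to the excess.
\<close>

lemma excess_busy_period:
  assumes "s \<le> t" and busy: "\<And>u. s \<le> u \<Longrightarrow> u < t \<Longrightarrow> busy l u"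
  shows "excess l t \<le> excess l s + (\<Sum>j<n. crossings a (w 0) s t j) - int p * int (t - s)
    - (\<Sum>j\<in>{..<n} - above l s. min 1 (crossings a (w 0) s t j))"
proof -
  define c where "c = crossings a (w 0) s t"
  have "excess l t \<le> (\<Sum>j<n. max 0 (\<lfloor>w s j\<rfloor> - int l) + c j - removed s t j
    - (if j \<in> {..<n} - above l s then min 1 (c j) else 0))"
    unfolding excess_def
  proof (rule sum_mono)
    fix j assume "j \<in> {..<n}"
    then have j: "j < n" by simp
    have fl: "\<lfloor>w t j\<rfloor> = \<lfloor>w s j\<rfloor> + c j - removed s t j"
      unfolding c_def by (rule floor_w_eq[OF j assms(1)])
    have nn: "0 \<le> c j" "0 \<le> removed s t j"
      using crossings_nonneg[OF j assms(1)] removed_nonneg by (auto simp: c_def)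
    have high: "removed s t j \<noteq> 0 \<Longrightarrow> int l \<le> \<lfloor>w t j\<rfloor>"
      using removed_imp_high[OF assms(1) busy j] by (simp add: le_floor_iff)
    have ab: "j \<in> above l s \<longleftrightarrow> int l \<le> \<lfloor>w s j\<rfloor>" using j by (simp add: above_def le_floor_iff)
    show "max 0 (\<lfloor>w t j\<rfloor> - int l) \<le> max 0 (\<lfloor>w s j\<rfloor> - int l) + c j - removed s t j
      - (if j \<in> {..<n} - above l s then min 1 (c j) else 0)"
      using fl nn high ab j by (cases "j \<in> above l s"; cases "removed s t j = 0") auto
  qed
  also have "\<dots> = excess l s + (\<Sum>j<n. c j) - (\<Sum>j<n. removed s t j)
    - (\<Sum>j<n. if j \<in> {..<n} - above l s then min 1 (c j) else 0)"
    by (simp add: excess_def sum.distrib sum_subtractf)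
  also have "(\<Sum>j<n. if j \<in> {..<n} - above l s then min 1 (c j) else 0)
      = (\<Sum>j\<in>{..<n} - above l s. min 1 (c j))"
    by (subst sum.inter_restrict[symmetric]) (auto intro: sum.cong)
  finally show ?thesis using sum_removed[of s t l] busy by (simp add: c_def)
qed

text \<open>Since the last idle step, crossings outnumber removals by at most the error
  \<open>\<delta> V + L / \<delta>\<close>, where \<open>V\<close> is the reach. For
  \<open>V \<le> B\<close> this suffices. For larger \<open>V\<close>, all but \<open>B\<close> cups
  start below \<open>l\<close>, and their harmless first crossings, at least \<open>V - B\<close> up
  to the same error, outweigh the growth in \<open>V\<close> because
  \<open>\<delta> \<le> 1 / 2\<close>.\<close>

lemma excess_step:
  fixes B :: real
  assumes "1 \<le> l" and \<delta>: "0 < \<delta>" "\<delta> \<le> 1 / 2" and L: "0 \<le> L" and B: "0 \<le> B"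
    and conc: "\<And>s. s \<le> t \<Longrightarrow> concentrated n a \<delta> L s t (w 0)"
    and few: "\<And>s. s \<le> t \<Longrightarrow> card (above l s) \<le> B"
    and H: "\<And>s j. s \<le> t \<Longrightarrow> j < n \<Longrightarrow> w s j \<le> H" "0 \<le> H"
  shows "excess l t \<le> real p * H + 2 * \<delta> * B + 2 * L / \<delta>"
proof -
  obtain s where s: "s \<le> t" "\<And>u. s \<le> u \<Longrightarrow> u < t \<Longrightarrow> busy l u" "s = 0 \<or> \<not> busy l (s - 1)"
    using last_idle[of t l] by blast
  define c where "c j = real_of_int (crossings a (w 0) s t j)" for j
  define V where "V = reach n a s t"
  define D where "D = (\<Sum>j\<in>{..<n} - above l s. min 1 (c j))"
  have c: "0 \<le> c j" if "j < n" for j using crossings_nonneg[OF that s(1)] by (simp add: c_def)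
  have min_c: "real_of_int (min 1 (crossings a (w 0) s t j)) = min 1 (c j)" for j
    by (simp add: c_def min_def)
  have "real_of_int (excess l t) \<le> real_of_int (excess l s + (\<Sum>j<n. crossings a (w 0) s t j)
      - int p * int (t - s) - (\<Sum>j\<in>{..<n} - above l s. min 1 (crossings a (w 0) s t j)))"
    using excess_busy_period[OF s(1,2)] by (subst of_int_le_iff) auto
  also have "\<dots> = excess l s + (\<Sum>j<n. c j) - real p * real (t - s) - D"
    by (simp add: D_def c_def min_c[unfolded c_def] del: of_int_min)
  finally have ex: "excess l t \<le> excess l s + (\<Sum>j<n. c j) - real p * real (t - s) - D" .
  have e0: "excess l s \<le> real p * H"
    using s H by (intro excess_after_idle assms(1)) auto
  have "(\<Sum>j<n. c j) \<le> (\<Sum>j<n. added a s t j) + (\<delta> * V + L / \<delta>)"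
    using conc[OF s(1)] by (simp add: concentrated_def c_def V_def)
  then have cr: "(\<Sum>j<n. c j) \<le> real p * real (t - s) + (\<delta> * V + L / \<delta>)"
    using sum_added_le[OF s(1)] by simp
  have D0: "0 \<le> D" unfolding D_def using c by (intro sum_nonneg) auto
  have "(\<Sum>j\<in>above l s. min 1 (c j)) \<le> real (card (above l s)) * 1"
    by (rule sum_bounded_above) auto
  also have "\<dots> \<le> B" using few[OF s(1)] by simp
  finally have "(\<Sum>j<n. min 1 (c j)) \<le> D + B"
    using sum.subset_diff[of "above l s" "{..<n}" "\<lambda>j. min 1 (c j)"]
    by (simp add: D_def subset_eq) (simp add: above_def)
  then have D1: "V - (\<delta> * V + L / \<delta>) - B \<le> D"
    using conc[OF s(1)] by (simp add: concentrated_def V_def min_c del: of_int_min)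
  have Ld: "0 \<le> L / \<delta>" using L \<delta> by simp
  have "excess l t \<le> real p * H + 2 * (\<delta> * B) + 2 * (L / \<delta>)"
  proof (cases "V \<le> B")
    case True
    then have "\<delta> * V \<le> \<delta> * B" using \<delta> by simp
    moreover have "0 \<le> \<delta> * B" using \<delta> B by simp
    ultimately show ?thesis using ex e0 cr D0 Ld by linarith
  next
    case False
    then have "(1 - 2 * \<delta>) * B \<le> (1 - 2 * \<delta>) * V" using \<delta> by (intro mult_left_mono) auto
    then have "2 * (\<delta> * V) - V + B \<le> 2 * (\<delta> * B)" by (simp add: algebra_simps)
    then show ?thesis using ex e0 cr D1 by linarith
  qed
  then show ?thesis by simp
qed

end

subsection \<open>Iteration over the levels\<close>

text \<open>This is \<open>4 E n^(1/2^i)\<close>: each level replaces the power of \<open>n\<close>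
  by its square root.\<close>

definition level_bound :: "real \<Rightarrow> nat \<Rightarrow> nat \<Rightarrow> real" where
  "level_bound E n i = 4 * E * exp (ln (real n) / 2 ^ i)"

text \<open>The value of \<open>\<delta>\<close> that minimises
  \<open>\<delta> b + L / \<delta>\<close> for \<open>b = level_bound E n i\<close>.\<close>

definition level_slack :: "real \<Rightarrow> real \<Rightarrow> nat \<Rightarrow> nat \<Rightarrow> real" where
  "level_slack L E n i = sqrt (L / level_bound E n i)"

lemma level_bound_ge:
  assumes "1 \<le> n" "0 \<le> E"
  shows "4 * E \<le> level_bound E n i"
  using assms by (simp add: level_bound_def mult_le_cancel_left1)

lemma level_slack_bounds:
  assumes "1 \<le> n" "0 < L" "16 * L \<le> E"
  shows "0 < level_slack L E n i" "level_slack L E n i \<le> 1 / 2"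
proof -
  have b: "64 * L \<le> level_bound E n i" using level_bound_ge[of n E i] assms by simp
  then show "0 < level_slack L E n i" using assms by (simp add: level_slack_def)
  have "L / level_bound E n i \<le> (1 / 2)\<^sup>2" using b assms by (simp add: field_simps power2_eq_square)
  then show "level_slack L E n i \<le> 1 / 2" unfolding level_slack_def by (intro real_le_lsqrt) auto
qed

text \<open>With this slack both error terms equal \<open>2 sqrt (L b)\<close>. Since
  \<open>16 L \<le> E\<close>, together they are at most \<open>2 E z\<close> for
  \<open>z = n^(1/2^(i+1))\<close>, and \<open>x\<close> adds at most another
  \<open>E z\<close>.\<close>

lemma level_bound_Suc:
  assumes "1 \<le> n" "0 < L" "x + 16 * L \<le> E" "0 \<le> x"
  shows "x + 2 * level_slack L E n i * level_bound E n i + 2 * L / level_slack L E n i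
    \<le> level_bound E n (Suc i)"
proof -
  define b z where "b = level_bound E n i" and "z = exp (ln (real n) / 2 ^ Suc i)"
  have E: "0 < E" using assms by simp
  have z1: "1 \<le> z" using assms by (simp add: z_def)
  have "exp (ln (real n) / 2 ^ i) = z\<^sup>2" by (simp add: z_def flip: exp_of_nat_mult)
  then have b: "b = 4 * E * z\<^sup>2" by (simp add: b_def level_bound_def)
  have b0: "0 < b" using b E z1 by simp
  have "sqrt (L / b) * b = sqrt (L * b)" "L / sqrt (L / b) = sqrt (L * b)"
    using b0 assms real_sqrt_mult_self[of b] real_sqrt_mult_self[of L]
    by (auto simp: real_sqrt_mult real_sqrt_divide field_simps)
  moreover have "2 * sqrt (L * b) \<le> E * z"
  proof -
    have "sqrt (L * b) \<le> E * z / 2"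
    proof (rule real_le_lsqrt)
    have "L * b \<le> (E / 16) * b" using b0 assms by (intro mult_right_mono) auto
    also have "\<dots> = (E * z / 2)\<^sup>2" by (simp add: b power2_eq_square)
    finally show "L * b \<le> (E * z / 2)\<^sup>2" .
    qed (use E z1 in auto)
    then show ?thesis by simp
  qed
  moreover have "x \<le> E * z"
  proof -
    have "E * 1 \<le> E * z" using E z1 by (intro mult_left_mono) auto
    then have "E \<le> E * z" by (simp only: mult_1_right)
    then show ?thesis using assms by linarith
  qed
  moreover have "level_bound E n (Suc i) = 4 * (E * z)" by (simp add: level_bound_def z_def)
  moreover have "0 \<le> E * z" using E z1 by simp
  ultimately show ?thesis
    by (simp add: level_slack_def b_def[symmetric] mult.assoc times_divide_eq_right[symmetric]
        del: times_divide_eq_right)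
qed

context greedy_run
begin

text \<open>Induction over the levels: a cup at level \<open>l + 1\<close> adds at least 1 to the
  excess over \<open>l\<close>, so the bound for one level limits the number of cups at the next.
  The induction starts at level 1, which no initial fill exceeds, with the trivial count
  \<open>n\<close>.\<close>

lemma excess_le_level_bound:
  assumes L: "1 \<le> L" and H: "\<And>s j. j < n \<Longrightarrow> w s j \<le> H" "0 \<le> H" and E: "real p * H + 16 * L \<le> E"
    and conc: "\<And>i s t. i < k \<Longrightarrow> s \<le> t \<Longrightarrow> t \<le> T \<Longrightarrow>
      concentrated n a (level_slack L E n i) L s t (w 0)"
    and "i < k" "t \<le> T"
  shows "excess (Suc i) t \<le> level_bound E n (Suc i)"
  using assms(6,7)
proof (induction i arbitrary: t)
  have n1: "1 \<le> n" using p_pos p_le by simp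
  have pH: "0 \<le> real p * H" using H by simp
  have step: "excess (Suc i) t \<le> level_bound E n (Suc i)"
    if i: "i < k" and t: "t \<le> T" and few: "\<And>s. s \<le> t \<Longrightarrow> card (above (Suc i) s) \<le> level_bound E n i"
    for i t
  proof -
    have "excess (Suc i) t \<le> real p * H + 2 * level_slack L E n i * level_bound E n i
        + 2 * L / level_slack L E n i"
    proof (rule excess_step)
      show "concentrated n a (level_slack L E n i) L s t (w 0)" if "s \<le> t" for s
        using conc[OF i that t] .
      show "0 < level_slack L E n i" "level_slack L E n i \<le> 1 / 2"
        using level_slack_bounds[of n L E i] n1 L E pH by auto
      show "0 \<le> level_bound E n i" using E pH L by (simp add: level_bound_def)
    qed (use L H few in auto)
    also have "\<dots> \<le> level_bound E n (Suc i)"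
      using n1 L E pH by (intro level_bound_Suc) auto
    finally show ?thesis .
  qed
  {
    case 0
    have "card (above (Suc 0) s) \<le> n" for s
      using card_mono[of "{..<n}" "above (Suc 0) s"] by (auto simp: above_def)
    moreover have "real n \<le> level_bound E n 0"
      using n1 E L pH by (simp add: level_bound_def mult_le_cancel_right1)
    ultimately show ?case using 0 by (intro step) (auto intro: order.trans[OF of_nat_mono])
  next
    case (Suc i)
    have "real (card (above (Suc (Suc i)) s)) \<le> level_bound E n (Suc i)" if "s \<le> t" for s
    proof -
      have "real (card (above (Suc (Suc i)) s)) \<le> excess (Suc i) s"
        using card_above_le_excess[of "Suc i" s] by (metis of_int_le_iff of_int_of_nat_eq)
      also have "\<dots> \<le> level_bound E n (Suc i)" using Suc that by auto
      finally show ?thesis .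
    qed
    then show ?case using Suc.prems by (intro step) auto
  }
qed

text \<open>After \<open>k\<close> levels the factor \<open>n^(1/2^k)\<close> is at most
  \<open>exp 1\<close>, so the excess over \<open>k\<close> is at most \<open>12 E\<close>. Rounding
  down loses less than 1 per cup, so \<open>fill_le\<close> applies with
  \<open>\<mu> = k + 1\<close>.\<close>

lemma fill_le_concentrated:
  assumes L: "1 \<le> L" and H: "H = 3 + 2 * ln (2 * real n)" and E: "E = real p * H + 16 * L"
    and conc: "\<And>i s t. i < k \<Longrightarrow> s \<le> t \<Longrightarrow> t \<le> T \<Longrightarrow>
      concentrated n a (level_slack L E n i) L s t (w 0)"
    and k: "0 < k" "ln (real n) \<le> 2 ^ k"
    and M: "12 * E \<le> real M"
    and "t \<le> T" "j < n"
  shows "w t j \<le> real k + 2 + harm (M + p) + harm p"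
proof -
  have n1: "1 \<le> n" using p_pos p_le by simp
  have H0: "0 \<le> H" using n1 by (simp add: H)
  have E0: "0 < E" unfolding E using L H0 by (intro add_nonneg_pos mult_nonneg_nonneg) auto
  have "exp (ln (real n) / 2 ^ k) \<le> exp 1" using k by (simp add: field_simps)
  also have "\<dots> \<le> (3::real)" by (rule exp_le)
  finally have "level_bound E n k \<le> 4 * E * 3"
    unfolding level_bound_def using E0 by (intro mult_left_mono) auto
  then have bM: "level_bound E n k \<le> real M" using M by simp
  have ex: "excess k s \<le> real M" if "s \<le> t" for s
  proof -
    have "real_of_int (excess (Suc (k - 1)) s) \<le> level_bound E n (Suc (k - 1))"
    proof (rule excess_le_level_bound[OF L _ H0])
      show "w s j \<le> H" if "j < n" for s j using fill_le_log[OF that] H by simp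
      show "concentrated n a (level_slack L E n i) L s t (w 0)"
        if "i < k" "s \<le> t" "t \<le> T" for i s t using conc that by blast
    qed (use E k assms(8) that in auto)
    then show ?thesis using bM k by simp
  qed
  have "w t j \<le> (real k + 1) + 1 + harm (M + p) + harm p"
  proof (rule fill_le)
    fix s U assume s: "s \<le> t" and U: "U \<subseteq> {..<n}"
    have "(\<Sum>j\<in>U. w s j) \<le> (\<Sum>j\<in>U. real k + 1 + of_int (max 0 (\<lfloor>w s j\<rfloor> - int k)))"
      by (intro sum_mono) linarith
    also have "\<dots> = real (card U) * (real k + 1) + of_int (\<Sum>j\<in>U. max 0 (\<lfloor>w s j\<rfloor> - int k))"
      by (simp add: sum.distrib)
    also have "(\<Sum>j\<in>U. max 0 (\<lfloor>w s j\<rfloor> - int k)) \<le> excess k s"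
      unfolding excess_def using U by (intro sum_mono2) auto
    also have "real_of_int (excess k s) \<le> real M" using ex s by simp
    finally show "(\<Sum>j\<in>U. w s j) \<le> real (card U) * (real k + 1) + real M" by simp
  qed (use assms(9) in auto)
  then show ?thesis by simp
qed

end

subsection \<open>Concentration of the threshold crossings\<close>

lemma exp_le_quadratic:
  fixes s :: real
  assumes "\<bar>s\<bar> \<le> 1"
  shows "exp s \<le> 1 + s + s\<^sup>2"
proof (cases "0 \<le> s")
  case True
  then show ?thesis using assms by (intro exp_bound) auto
next
  case False
  define u where "u = - s"
  have u: "0 < u" using False by (simp add: u_def)
  have "1 \<le> (1 + u) * (1 - u + u\<^sup>2)"
    using u by (simp add: algebra_simps power2_eq_square)
  then have "1 / (1 + u) \<le> 1 - u + u\<^sup>2" using u by (simp add: divide_simps mult.commute)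
  moreover have "exp (- u) \<le> 1 / (1 + u)"
    using u exp_ge_add_one_self[of u] by (simp add: exp_minus divide_simps)
  ultimately show ?thesis by (simp add: u_def)
qed

section \<open>Rounding by a uniform offset\<close>

abbreviation unit_uniform :: "real measure" where
  "unit_uniform \<equiv> uniform_measure lborel {0..1}"

lemma prob_space_unit_uniform: "prob_space unit_uniform"
  by (intro prob_space_uniform_measure) auto

lemma AE_unit_uniform: "AE x in unit_uniform. 0 \<le> x \<and> x \<le> 1"
  by (intro AE_uniform_measureI) auto

lemma integral_floor_unit_uniform:
  fixes \<alpha> :: real
  shows "integrable unit_uniform (\<lambda>x. real_of_int \<lfloor>x + \<alpha>\<rfloor>)"
    and "(\<integral>x. real_of_int \<lfloor>x + \<alpha>\<rfloor> \<partial>unit_uniform) = \<alpha>"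
proof -
  interpret prob_space unit_uniform by (rule prob_space_unit_uniform)
  \<comment> \<open>On the unit interval the floor of \<open>x + \<alpha>\<close> jumps exactly at
    \<open>1 - frac \<alpha>\<close>, so it is a constant plus an indicator of probability
    \<open>frac \<alpha>\<close>.\<close>
  define g where "g x = real_of_int \<lfloor>\<alpha>\<rfloor> + indicator {1 - frac \<alpha>..1} x" for x :: real
  have ae: "AE x in unit_uniform. g x = real_of_int \<lfloor>x + \<alpha>\<rfloor>"
    using AE_unit_uniform
  proof eventually_elim
    case (elim x)
    have f: "\<alpha> = \<lfloor>\<alpha>\<rfloor> + frac \<alpha>" "0 \<le> frac \<alpha>" "frac \<alpha> < 1"
      by (auto simp: frac_def) linarith
    show ?case
    proof (cases "1 - frac \<alpha> \<le> x")
      case True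
      then have "\<lfloor>x + \<alpha>\<rfloor> = \<lfloor>\<alpha>\<rfloor> + 1"
        unfolding floor_eq_iff using f elim by auto
      then show ?thesis using True elim by (simp add: g_def)
    next
      case False
      then have "\<lfloor>x + \<alpha>\<rfloor> = \<lfloor>\<alpha>\<rfloor>"
        unfolding floor_eq_iff using f elim False by (intro conjI) linarith+
      then show ?thesis using False by (simp add: g_def)
    qed
  qed
  have int_g: "integrable unit_uniform g"
    unfolding g_def by (intro Bochner_Integration.integrable_add integrable_const)
      (simp add: integrable_indicator_iff emeasure_eq_measure)
  show "integrable unit_uniform (\<lambda>x. real_of_int \<lfloor>x + \<alpha>\<rfloor>)"
    by (rule integrable_cong_AE_imp[OF int_g _ ae]) measurable
  have "(\<integral>x. real_of_int \<lfloor>x + \<alpha>\<rfloor> \<partial>unit_uniform) = (\<integral>x. g x \<partial>unit_uniform)"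
    using ae int_g by (intro integral_cong_AE) (auto elim: eventually_mono)
  also have "\<dots> = real_of_int \<lfloor>\<alpha>\<rfloor> + measure unit_uniform {1 - frac \<alpha>..1}"
    unfolding g_def by (subst Bochner_Integration.integral_add) (auto simp: prob_space emeasure_eq_measure)
  also have "measure unit_uniform {1 - frac \<alpha>..1} = frac \<alpha>"
  proof -
    have "{0..1} \<inter> {1 - frac \<alpha>..1} = {1 - frac \<alpha>..1}" using frac_lt_1[of \<alpha>] by auto
    then show ?thesis using frac_ge_0[of \<alpha>] by (subst measure_uniform_measure) auto
  qed
  finally show "(\<integral>x. real_of_int \<lfloor>x + \<alpha>\<rfloor> \<partial>unit_uniform) = \<alpha>" by (simp add: frac_def)
qed

lemma (in prob_space) bernoulli_mgf_le:
  fixes X :: "'a \<Rightarrow> real"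
  assumes [measurable]: "X \<in> borel_measurable M" and X: "AE x in M. X x \<in> {0, 1}"
    and s: "\<bar>s\<bar> \<le> 1"
  shows "integrable M (\<lambda>x. exp (s * (X x - expectation X)))"
    and "expectation (\<lambda>x. exp (s * (X x - expectation X))) \<le> exp (s\<^sup>2 * expectation X)"
proof -
  define q where "q = expectation X"
  have int: "integrable M X"
    using X by (intro integrable_const_bound[where B = 1]) (auto elim!: eventually_mono)
  have q0: "0 \<le> q" unfolding q_def using X by (intro integral_nonneg_AE) (auto elim!: eventually_mono)
  \<comment> \<open>For \<open>X\<close> in \<open>{0, 1}\<close>, \<open>exp (s * X)\<close> is the
    affine function \<open>1 + (exp s - 1) * X\<close>, whose expectation is explicit.\<close>
  define g where "g x = exp (- s * q) * (1 + (exp s - 1) * X x)" for x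
  have [measurable]: "g \<in> borel_measurable M" unfolding g_def by measurable
  have int_g: "integrable M g" unfolding g_def using int by simp
  have ae: "AE x in M. g x = exp (s * (X x - q))"
    using X by eventually_elim (auto simp: g_def right_diff_distrib exp_diff exp_minus field_simps)
  show "integrable M (\<lambda>x. exp (s * (X x - expectation X)))"
    by (rule integrable_cong_AE_imp[OF int_g _ ae[unfolded q_def]]) measurable
  have "expectation (\<lambda>x. exp (s * (X x - q))) = expectation g"
    using ae by (intro integral_cong_AE) (auto elim: eventually_mono)
  also have "\<dots> = exp (- s * q) * (1 + (exp s - 1) * q)"
    unfolding g_def using int by (simp add: q_def prob_space)
  also have "\<dots> \<le> exp (- s * q) * exp ((exp s - 1) * q)"
    by (intro mult_left_mono exp_ge_add_one_self) auto
  also have "\<dots> = exp ((exp s - 1 - s) * q)" by (simp add: algebra_simps flip: exp_add)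
  also have "\<dots> \<le> exp (s\<^sup>2 * q)"
    using exp_le_quadratic[OF s] q0 by (simp add: mult_right_mono)
  finally show "expectation (\<lambda>x. exp (s * (X x - expectation X))) \<le> exp (s\<^sup>2 * expectation X)"
    by (simp add: q_def)
qed

section \<open>Chernoff bounds for independent offsets\<close>

lemma sets_random_offsets [measurable_cong]: "sets (random_offsets n) = sets (PiM {..<n} (\<lambda>_. borel))"
  unfolding random_offsets_def by (intro sets_PiM_cong) auto

lemma prob_space_random_offsets: "prob_space (random_offsets n)"
  unfolding random_offsets_def by (intro prob_space_PiM prob_space_unit_uniform)

lemma AE_random_offsets: "AE r in random_offsets n. \<forall>j\<in>{..<n}. 0 \<le> r j \<and> r j \<le> 1"
  unfolding random_offsets_def
  by (intro AE_finite_allI AE_PiM_component prob_space_unit_uniform AE_unit_uniform) auto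

text \<open>Markov's inequality for the product \<open>Y\<close> of the exponentials, whose
  expectation factorises by independence. A positive \<open>s\<close> controls the upper tail, a
  negative one the lower tail.\<close>

lemma chernoff_random_offsets:
  fixes X :: "nat \<Rightarrow> real \<Rightarrow> real"
  assumes [measurable]: "\<And>j. X j \<in> borel_measurable borel"
    and X: "\<And>j. j < n \<Longrightarrow> AE x in unit_uniform. X j x \<in> {0, 1}"
    and q: "\<And>j. j < n \<Longrightarrow> (\<integral>x. X j x \<partial>unit_uniform) = q j" and V: "(\<Sum>j<n. q j) \<le> V"
    and s: "\<bar>s\<bar> \<le> 1"
  shows "measure (random_offsets n)
    {r \<in> space (random_offsets n). s * ((\<Sum>j<n. X j (r j)) - (\<Sum>j<n. q j)) \<ge> s\<^sup>2 * V + L} \<le> exp (- L)"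
proof -
  interpret U: prob_space unit_uniform by (rule prob_space_unit_uniform)
  interpret product_sigma_finite "\<lambda>_::nat. unit_uniform" ..
  define Y where "Y r = (\<Prod>j<n. exp (s * (X j (r j) - q j)))" for r
  have mgf: "integrable unit_uniform (\<lambda>x. exp (s * (X j x - q j)))"
    "(\<integral>x. exp (s * (X j x - q j)) \<partial>unit_uniform) \<le> exp (s\<^sup>2 * q j)" if "j < n" for j
    using U.bernoulli_mgf_le[of "X j" s] X[OF that] s q[OF that] by auto
  have int: "integrable (random_offsets n) Y"
    unfolding random_offsets_def Y_def using mgf by (intro product_integrable_prod) auto
  have Y_eq: "Y r = exp (s * ((\<Sum>j<n. X j (r j)) - (\<Sum>j<n. q j)))" for r
    by (simp add: Y_def exp_sum sum_distrib_left flip: sum_subtractf)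
  have "{r \<in> space (random_offsets n). s * ((\<Sum>j<n. X j (r j)) - (\<Sum>j<n. q j)) \<ge> s\<^sup>2 * V + L}
      = {r \<in> space (random_offsets n). Y r \<ge> exp (s\<^sup>2 * V + L)}"
    by (simp add: Y_eq)
  also have "measure (random_offsets n) \<dots> \<le> (\<integral>r. Y r \<partial>random_offsets n) / exp (s\<^sup>2 * V + L)"
    by (rule integral_Markov_inequality_measure[where A = "{}", OF int])
      (auto simp: Y_def intro!: AE_I2 prod_nonneg)
  also have "(\<integral>r. Y r \<partial>random_offsets n) = (\<Prod>j<n. \<integral>x. exp (s * (X j x - q j)) \<partial>unit_uniform)"
    unfolding random_offsets_def Y_def using mgf by (intro product_integral_prod) auto
  also have "\<dots> \<le> (\<Prod>j<n. exp (s\<^sup>2 * q j))"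
    using mgf by (intro prod_mono) auto
  also have "\<dots> = exp (s\<^sup>2 * (\<Sum>j<n. q j))" by (simp add: exp_sum sum_distrib_left)
  also have "\<dots> \<le> exp (s\<^sup>2 * V)" using V by (simp add: mult_left_mono)
  also have "exp (s\<^sup>2 * V) / exp (s\<^sup>2 * V + L) = exp (- L)" by (simp add: exp_add exp_minus field_simps)
  finally show ?thesis by (simp add: divide_right_mono)
qed

lemma concentrated_measurable [measurable]:
  "Measurable.pred (random_offsets n) (concentrated n a \<delta> L s t)"
  unfolding concentrated_def crossings_def of_int_min of_int_diff of_int_1 by measurable

text \<open>The number of crossings of a cup is one of the two integers next to the amount added. A
  cup that receives at least 1 unit crosses for certain, so only the others make the number of
  crossing cups random. The two estimates are Chernoff bounds with \<open>s = \<delta>\<close> and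
  \<open>s = - \<delta>\<close>.\<close>

lemma prob_not_concentrated_le:
  assumes added: "\<And>j. j < n \<Longrightarrow> 0 \<le> added a s t j" and \<delta>: "0 < \<delta>" "\<delta> \<le> 1"
  shows "measure (random_offsets n) {r \<in> space (random_offsets n). \<not> concentrated n a \<delta> L s t r}
    \<le> 2 * exp (- L)"
proof -
  interpret U: prob_space unit_uniform by (rule prob_space_unit_uniform)
  interpret P: prob_space "random_offsets n" by (rule prob_space_random_offsets)
  define c where "c j x = \<lfloor>x + placed a t j\<rfloor> - \<lfloor>x + placed a s j\<rfloor>" for j and x :: real
  define V where "V = reach n a s t"
  define f where "f j = added a s t j" for j
  define X where "X j x = real_of_int (c j x - \<lfloor>f j\<rfloor>)" for j x
  \<comment> \<open>\<open>X\<close> and \<open>X'\<close> are shifted to be Bernoulli variables whose means add up to at most \<open>V\<close>.\<close>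
  define X' where "X' j x = real_of_int (min 1 (c j x) - (if 1 \<le> f j then 1 else 0))" for j x
  define q where "q j = frac (f j)" for j
  define q' where "q' j = (if 1 \<le> f j then 0 else f j)" for j
  have f0: "0 \<le> f j" if "j < n" for j using added[OF that] by (simp add: f_def)
  have V: "V = (\<Sum>j<n. min 1 (f j))" by (simp add: V_def reach_def f_def)
  have c_meas [measurable]: "(\<lambda>x. real_of_int (c j x)) \<in> borel_measurable borel" for j
    unfolding c_def of_int_diff by measurable
  have X_meas: "X j \<in> borel_measurable borel" for j unfolding X_def of_int_diff by measurable
  have X'_meas: "X' j \<in> borel_measurable borel" for j unfolding X'_def of_int_diff of_int_min by measurable
  have c_cases: "c j x = \<lfloor>f j\<rfloor> \<or> c j x = \<lfloor>f j\<rfloor> + 1" for j x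
    unfolding c_def f_def added_def by linarith
  have int_c: "integrable unit_uniform (\<lambda>x. real_of_int (c j x))"
    and E_c: "(\<integral>x. real_of_int (c j x) \<partial>unit_uniform) = f j" for j
    unfolding c_def of_int_diff f_def added_def
    by (auto simp: integral_floor_unit_uniform)
  have X_01: "X j x \<in> {0, 1}" for j x using c_cases[of j x] by (auto simp: X_def)
  have f_lt1: "\<lfloor>f j\<rfloor> = 0" if "\<not> 1 \<le> f j" "j < n" for j
    using f0[OF that(2)] that(1) by linarith
  have X'_eq: "X' j x = (if 1 \<le> f j then 0 else real_of_int (c j x))" if "j < n" for j x
  proof (cases "1 \<le> f j")
    case True
    then have "1 \<le> \<lfloor>f j\<rfloor>" by linarith
    then show ?thesis using True c_cases[of j x] by (auto simp: X'_def)
  next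
    case False
    then show ?thesis using f_lt1[OF False that] c_cases[of j x] by (auto simp: X'_def)
  qed
  have X'_01: "X' j x \<in> {0, 1}" if "j < n" for j x
    using X'_eq[OF that] c_cases[of j x] f_lt1[of j] that by auto
  have E_X: "(\<integral>x. X j x \<partial>unit_uniform) = q j" for j
    unfolding X_def of_int_diff using int_c[of j] E_c[of j] by (simp add: q_def frac_def U.prob_space)
  have E_X': "(\<integral>x. X' j x \<partial>unit_uniform) = q' j" if "j < n" for j
    using E_c[of j] by (simp add: X'_eq[OF that] q'_def)
  have "q j \<le> min 1 (f j)" if "j < n" for j
    using frac_lt_1[of "f j"] f0[OF that] by (simp add: q_def min_def frac_def)
  then have qV: "(\<Sum>j<n. q j) \<le> V" unfolding V by (intro sum_mono) auto
  have q'V: "(\<Sum>j<n. q' j) \<le> V" unfolding V using f0 by (intro sum_mono) (auto simp: q'_def)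
  define A where "A = {r \<in> space (random_offsets n). \<delta> * ((\<Sum>j<n. X j (r j)) - (\<Sum>j<n. q j)) \<ge> \<delta>\<^sup>2 * V + L}"
  define B where "B = {r \<in> space (random_offsets n). - \<delta> * ((\<Sum>j<n. X' j (r j)) - (\<Sum>j<n. q' j)) \<ge> (- \<delta>)\<^sup>2 * V + L}"
  have sets: "A \<in> sets (random_offsets n)" "B \<in> sets (random_offsets n)"
    unfolding A_def B_def using X_meas X'_meas by measurable
  have A: "measure (random_offsets n) A \<le> exp (- L)"
    unfolding A_def using \<delta> X_01 E_X qV X_meas by (intro chernoff_random_offsets) auto
  have B: "measure (random_offsets n) B \<le> exp (- L)"
    unfolding B_def using \<delta> X'_01 E_X' q'V X'_meas
    by (intro chernoff_random_offsets AE_I2) auto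
  have "{r \<in> space (random_offsets n). \<not> concentrated n a \<delta> L s t r} \<subseteq> A \<union> B"
  proof
    fix r assume "r \<in> {r \<in> space (random_offsets n). \<not> concentrated n a \<delta> L s t r}"
    then have r: "r \<in> space (random_offsets n)" and nc: "\<not> concentrated n a \<delta> L s t r" by auto
    have cr: "crossings a r s t j = c j (r j)" for j by (simp add: crossings_def c_def)
    have dL: "\<delta> * (\<delta> * V + L / \<delta>) = \<delta>\<^sup>2 * V + L" using \<delta> by (simp add: field_simps power2_eq_square)
    consider "(\<Sum>j<n. f j) + (\<delta> * V + L / \<delta>) \<le> (\<Sum>j<n. real_of_int (c j (r j)))"
      | "(\<Sum>j<n. real_of_int (min 1 (c j (r j)))) \<le> V - (\<delta> * V + L / \<delta>)"
      using nc by (force simp: concentrated_def cr V_def f_def)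
    then show "r \<in> A \<union> B"
    proof cases
      case 1
      have "(\<Sum>j<n. X j (r j)) - (\<Sum>j<n. q j) = (\<Sum>j<n. real_of_int (c j (r j))) - (\<Sum>j<n. f j)"
        by (simp add: X_def q_def frac_def flip: sum_subtractf)
      then have "\<delta> * (\<delta> * V + L / \<delta>) \<le> \<delta> * ((\<Sum>j<n. X j (r j)) - (\<Sum>j<n. q j))"
        using 1 \<delta> by (intro mult_left_mono) auto
      then show ?thesis using r unfolding A_def dL by auto
    next
      case 2
      have "(\<Sum>j<n. X' j (r j)) - (\<Sum>j<n. q' j)
          = (\<Sum>j<n. real_of_int (min 1 (c j (r j))) - min 1 (f j))"
        unfolding sum_subtractf[symmetric]
        by (intro sum.cong refl) (auto simp: X'_def q'_def)
      also have "\<dots> = (\<Sum>j<n. real_of_int (min 1 (c j (r j)))) - V" by (simp add: V sum_subtractf)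
      finally have "\<delta> * (\<delta> * V + L / \<delta>) \<le> \<delta> * (- ((\<Sum>j<n. X' j (r j)) - (\<Sum>j<n. q' j)))"
        using 2 \<delta> by (intro mult_left_mono) auto
      then show ?thesis using r unfolding B_def dL by (simp add: right_diff_distrib)
    qed
  qed
  then have "measure (random_offsets n) {r \<in> space (random_offsets n). \<not> concentrated n a \<delta> L s t r}
      \<le> measure (random_offsets n) (A \<union> B)"
    using sets by (intro P.finite_measure_mono) auto
  also have "\<dots> \<le> measure (random_offsets n) A + measure (random_offsets n) B"
    using sets by (rule measure_Un_le)
  finally show ?thesis using A B by simp
qed

subsection \<open>Measurability of the backlog event\<close>

lemma fullest_cups_exists: "p \<le> n \<Longrightarrow> \<exists>S. fullest_cups p n x S"
proof (induction p)
  case 0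
  then show ?case by (auto simp: fullest_cups_def)
next
  case (Suc p)
  then obtain S where S: "S \<subseteq> {..<n}" "card S = p" "\<forall>i\<in>S. \<forall>j\<in>{..<n} - S. x j \<le> x i"
    by (auto simp: fullest_cups_def)
  have fin: "finite S" using S by (auto intro: finite_subset)
  have ne: "{..<n} - S \<noteq> {}" using Suc.prems S card_mono[OF fin, of "{..<n}"] by auto
  have "Max (x ` ({..<n} - S)) \<in> x ` ({..<n} - S)" using ne by (intro Max_in) auto
  then obtain i where i: "i \<in> {..<n} - S" "x i = Max (x ` ({..<n} - S))" by auto
  have "\<forall>j\<in>{..<n} - S. x j \<le> x i" unfolding i(2) by auto
  then have "fullest_cups (Suc p) n x (insert i S)"
    using S i(1) fin by (auto simp: fullest_cups_def)
  then show ?case by blast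
qed

lemma fullest_cups_cong:
  assumes "\<And>j. j < n \<Longrightarrow> x j = y j"
  shows "fullest_cups p n x S \<longleftrightarrow> fullest_cups p n y S"
proof -
  have "S \<subseteq> {..<n} \<Longrightarrow> (\<forall>i\<in>S. \<forall>j\<in>{..<n} - S. x j \<le> x i) \<longleftrightarrow> (\<forall>i\<in>S. \<forall>j\<in>{..<n} - S. y j \<le> y i)"
    using assms by (intro ball_cong refl) auto
  then show ?thesis by (auto simp: fullest_cups_def)
qed

text \<open>
  The backlog event quantifies over all runs, of which there may be uncountably many. It is
  measurable since up to time \<open>T\<close> a run is determined by one of finitely many sequences of
  selected sets.
\<close>

primrec forced_run ::
    "(nat \<Rightarrow> nat \<Rightarrow> real) \<Rightarrow> (nat \<Rightarrow> (nat \<Rightarrow> real) \<Rightarrow> nat set) \<Rightarrow> (nat \<Rightarrow> real) \<Rightarrow> nat \<Rightarrow> nat \<Rightarrow> real" where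
  "forced_run a pick r 0 = r"
| "forced_run a pick r (Suc t) = (\<lambda>j.
     if j \<in> pick t (\<lambda>i. forced_run a pick r t i + a t i) \<and> 1 \<le> forced_run a pick r t j + a t j
     then forced_run a pick r t j + a t j - 1 else forced_run a pick r t j + a t j)"

lemma forced_run_cong:
  assumes "\<And>u x. u < t \<Longrightarrow> pick u x = pick' u x"
  shows "forced_run a pick r t = forced_run a pick' r t"
  using assms by (induction t) auto

lemma forced_run_measurable:
  "j < n \<Longrightarrow> (\<lambda>r. forced_run a (\<lambda>t _. C t) r t j) \<in> borel_measurable (random_offsets n)"
proof (induction t arbitrary: j)
  case 0
  then show ?case by (simp add: measurable_component_singleton cong: measurable_cong_sets)
next
  case (Suc t)
  note Suc.IH[OF Suc.prems, measurable]
  show ?case by simp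
qed

lemma smoothed_greedy_run_iff_forced:
  assumes "p \<le> n" and P: "\<And>x y. (\<And>j. j < n \<Longrightarrow> x j = y j) \<Longrightarrow> P x \<longleftrightarrow> P y"
  shows "(\<forall>w. smoothed_greedy_run p n a r w \<longrightarrow> (\<forall>t\<ge>1. t \<le> T \<longrightarrow> P (w t))) \<longleftrightarrow>
    (\<forall>C\<in>{..<T} \<rightarrow>\<^sub>E Pow {..<n}.
      (\<forall>t\<in>{..<T}. fullest_cups p n (\<lambda>j. forced_run a (\<lambda>t _. C t) r t j + a t j) (C t)) \<longrightarrow>
      (\<forall>t\<in>{1..T}. P (forced_run a (\<lambda>t _. C t) r t)))"
    (is "?lhs \<longleftrightarrow> ?rhs")
proof
  assume lhs: ?lhs
  show ?rhs
  proof (intro ballI impI)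
    fix C t
    assume full: "\<forall>t\<in>{..<T}. fullest_cups p n (\<lambda>j. forced_run a (\<lambda>t _. C t) r t j + a t j) (C t)"
      and t: "t \<in> {1..T}"
    \<comment> \<open>From time \<open>T\<close> on, arbitrary fullest sets continue the prescribed
      choices to an infinite run.\<close>
    define pick where "pick t x = (if t < T then C t else SOME S. fullest_cups p n x S)" for t x
    have eq: "forced_run a pick r u = forced_run a (\<lambda>t _. C t) r u" if "u \<le> T" for u
      using that by (intro forced_run_cong) (auto simp: pick_def)
    have "fullest_cups p n (\<lambda>j. forced_run a pick r u j + a u j)
        (pick u (\<lambda>j. forced_run a pick r u j + a u j))" for u
    proof (cases "u < T")
      case True
      then show ?thesis using full eq[of u] by (simp add: pick_def)
    next
      case False
      then show ?thesis
        using someI_ex[OF fullest_cups_exists[OF assms(1)]] by (simp add: pick_def)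
    qed
    then have "smoothed_greedy_run p n a r (forced_run a pick r)"
      unfolding smoothed_greedy_run_def smoothed_greedy_move_def by auto
    then have "P (forced_run a pick r t)" using lhs t by auto
    then show "P (forced_run a (\<lambda>t _. C t) r t)" using eq[of t] t by simp
  qed
next
  assume rhs: ?rhs
  show ?lhs
  proof (intro allI impI)
    fix w t assume run: "smoothed_greedy_run p n a r w" and t: "1 \<le> t" "t \<le> T"
    obtain S where S: "\<And>t. fullest_cups p n (\<lambda>j. w t j + a t j) (S t)"
      and stp: "\<And>t j. j < n \<Longrightarrow> w (Suc t) j =
        (if j \<in> S t \<and> 1 \<le> w t j + a t j then w t j + a t j - 1 else w t j + a t j)"
      using run unfolding smoothed_greedy_run_def smoothed_greedy_move_def by metis
    \<comment> \<open>The restriction makes the choices an element of a finite set of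
      functions.\<close>
    define C where "C = restrict S {..<T}"
    have C: "C \<in> {..<T} \<rightarrow>\<^sub>E Pow {..<n}" using S by (auto simp: C_def fullest_cups_def)
    have eq: "forced_run a (\<lambda>t _. C t) r u j = w u j" if "u \<le> T" "j < n" for u j
      using that
    proof (induction u arbitrary: j)
      case 0
      then show ?case using run by (simp add: smoothed_greedy_run_def)
    next
      case (Suc u)
      then show ?case by (simp add: stp C_def)
    qed
    have "\<forall>u\<in>{..<T}. fullest_cups p n (\<lambda>j. forced_run a (\<lambda>t _. C t) r u j + a u j) (C u)"
    proof
      fix u assume "u \<in> {..<T}"
      then show "fullest_cups p n (\<lambda>j. forced_run a (\<lambda>t _. C t) r u j + a u j) (C u)"
        using S[of u] eq[of u]
        by (subst fullest_cups_cong[where y = "\<lambda>j. w u j + a u j"]) (auto simp: C_def)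
    qed
    then have "P (forced_run a (\<lambda>t _. C t) r t)" using rhs C t by auto
    moreover have "P (forced_run a (\<lambda>t _. C t) r t) \<longleftrightarrow> P (w t)"
      by (rule P) (use eq t in auto)
    ultimately show "P (w t)" by simp
  qed
qed

lemma sets_backlog_event:
  assumes "p \<le> n" "0 < n"
  shows "{r \<in> space (random_offsets n). \<forall>w. smoothed_greedy_run p n a r w \<longrightarrow>
    (\<forall>t\<ge>1. t \<le> T \<longrightarrow> backlog n (w t) \<le> b)} \<in> sets (random_offsets n)"
proof -
  have bl: "backlog n x \<le> b \<longleftrightarrow> (\<forall>j\<in>{..<n}. x j \<le> b)" for x
    unfolding backlog_def using assms(2) by (subst Max_le_iff) auto
  have eq: "(\<forall>w. smoothed_greedy_run p n a r w \<longrightarrow> (\<forall>t\<ge>1. t \<le> T \<longrightarrow> backlog n (w t) \<le> b)) \<longleftrightarrow>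
    (\<forall>C\<in>{..<T} \<rightarrow>\<^sub>E Pow {..<n}.
      (\<forall>t\<in>{..<T}. fullest_cups p n (\<lambda>j. forced_run a (\<lambda>t _. C t) r t j + a t j) (C t)) \<longrightarrow>
      (\<forall>t\<in>{1..T}. \<forall>j\<in>{..<n}. forced_run a (\<lambda>t _. C t) r t j \<le> b))" for r
    unfolding bl by (rule smoothed_greedy_run_iff_forced[OF assms(1)]) auto
  have full: "Measurable.pred (random_offsets n)
      (\<lambda>r. fullest_cups p n (\<lambda>j. forced_run a (\<lambda>t _. C t) r t j + a t j) (C t))"
    if "C t \<subseteq> {..<n}" for C t
  proof -
    have fin: "finite (C t)" using that by (rule finite_subset) simp
    have "Measurable.pred (random_offsets n)
        (\<lambda>r. forced_run a (\<lambda>t _. C t) r t j + a t j \<le> forced_run a (\<lambda>t _. C t) r t i + a t i)"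
      if "i < n" "j < n" for i j
      unfolding pred_def using that
      by (intro borel_measurable_le borel_measurable_add borel_measurable_const forced_run_measurable)
    then show ?thesis
      unfolding fullest_cups_def using that
      by (intro pred_intros_logic pred_intros_finite fin finite_Diff finite_lessThan) auto
  qed
  have low: "Measurable.pred (random_offsets n) (\<lambda>r. forced_run a (\<lambda>t _. C t) r t j \<le> b)"
    if "j \<in> {..<n}" for C t j
  proof -
    have [measurable]: "(\<lambda>r. forced_run a (\<lambda>t _. C t) r t j) \<in> borel_measurable (random_offsets n)"
      using that by (intro forced_run_measurable) auto
    show ?thesis by measurable
  qed
  have sub: "C t \<subseteq> {..<n}" if "C \<in> {..<T} \<rightarrow>\<^sub>E Pow {..<n}" "t \<in> {..<T}" for C t
    using that by auto
  show ?thesis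
    unfolding eq pred_def[symmetric]
    by (intro pred_intros_finite finite_PiE finite_lessThan finite_Pow_iff[THEN iffD2] pred_intros_logic
        full finite_atLeastAtMost low sub)
qed

lemma concentrated_cong:
  assumes "\<And>j. j < n \<Longrightarrow> r j = r' j"
  shows "concentrated n a \<delta> L s t r \<longleftrightarrow> concentrated n a \<delta> L s t r'"
  using assms by (simp add: concentrated_def crossings_def)

subsection \<open>The probability of a large backlog\<close>

text \<open>Makes \<open>ln (ln n)\<close> positive from \<open>n = 3\<close> on. The fourth power
  of \<open>exp (1 / 4) \<le> 1 + 1 / 4 + 1 / 16\<close> stays strictly below 3.\<close>

lemma ln_3_gt_1: "1 < ln (3 :: real)"
proof -
  have "exp (1 / 4 :: real) \<le> 21 / 16" using exp_bound[of "1 / 4 :: real"] by (simp add: power2_eq_square)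
  then have "exp (1 / 4 :: real) ^ 4 \<le> (21 / 16) ^ 4" by (intro power_mono) auto
  also have "exp (1 / 4 :: real) ^ 4 = exp 1" by (simp flip: exp_of_nat_mult)
  finally have "exp 1 < (3 :: real)" by (simp add: power_numeral_reduce)
  then show ?thesis using ln_less_cancel_iff[of "exp 1" "3 :: real"] by simp
qed

text \<open>Union bound over \<open>k\<close> levels and at most \<open>(T + 1)^2\<close> pairs of
  times. Obliviousness enters here: the amounts added do not depend on the offsets.\<close>

lemma prob_all_concentrated:
  fixes n p k T :: nat
  assumes n: "1 \<le> n" and a: "oblivious_filler p n a" and L: "0 < L" "16 * L \<le> E"
  defines "M \<equiv> random_offsets n"
  defines "B \<equiv> \<Union>(i, s, t) \<in> {..<k} \<times> {(s, t). s \<le> t \<and> t \<le> T}.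
    {r \<in> space M. \<not> concentrated n a (level_slack L E n i) L s t r}"
  shows "B \<in> sets M" and "measure M B \<le> 2 * real k * (real T + 1)\<^sup>2 * exp (- L)"
proof -
  interpret prob_space M unfolding M_def by (rule prob_space_random_offsets)
  define I where "I = {..<k} \<times> {(s, t). s \<le> t \<and> t \<le> T}"
  have sub: "{(s, t). s \<le> t \<and> t \<le> T} \<subseteq> {..T} \<times> {..T}" by auto
  then have fin: "finite I" unfolding I_def by (intro finite_cartesian_product finite_subset[OF sub]) auto
  have "card {(s, t). s \<le> t \<and> t \<le> T} \<le> card ({..T} \<times> {..T})" using sub by (intro card_mono) auto
  then have "k * card {(s, t). s \<le> t \<and> t \<le> T} \<le> k * card ({..T} \<times> {..T})"
    by (rule mult_le_mono2)
  then have "card I \<le> k * ((T + 1) * (T + 1))"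
    unfolding I_def card_cartesian_product card_lessThan card_atMost Suc_eq_plus1 .
  then have "real (card I) \<le> real (k * ((T + 1) * (T + 1)))" by (rule of_nat_mono)
  also have "\<dots> = real k * (real T + 1)\<^sup>2" by (simp add: power2_eq_square algebra_simps)
  finally have card: "real (card I) \<le> real k * (real T + 1)\<^sup>2" .
  define N where "N = (\<lambda>(i, s, t). {r \<in> space M. \<not> concentrated n a (level_slack L E n i) L s t r})"
  have N_sets: "N ` I \<subseteq> sets M"
    by (auto simp: N_def M_def)
  have B: "B = (\<Union>x\<in>I. N x)" unfolding B_def I_def N_def by simp
  show "B \<in> sets M" unfolding B using fin N_sets by (intro sets.finite_UN) auto
  have N_le: "measure M (N x) \<le> 2 * exp (- L)" if x_in: "x \<in> I" for x
  proof -
    obtain i s t where x: "x = (i, s, t)" "s \<le> t" using x_in by (cases x) (auto simp: I_def)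
    have "0 \<le> added a s t j" if "j < n" for j
    proof -
      have "(\<Sum>u<s. a u j) \<le> (\<Sum>u<t. a u j)"
        using x that a by (intro sum_mono2) (auto simp: oblivious_filler_def legal_placement_def)
      then show ?thesis by (simp add: added_def placed_def)
    qed
    then show ?thesis
      unfolding x N_def M_def using level_slack_bounds[OF n L, of i]
      by (simp add: prob_not_concentrated_le)
  qed
  have "measure M B \<le> (\<Sum>x\<in>I. measure M (N x))"
    unfolding B by (rule finite_measure_subadditive_finite[OF fin N_sets])
  also have "\<dots> \<le> real (card I) * (2 * exp (- L))" using N_le by (rule sum_bounded_above)
  also have "\<dots> \<le> real k * (real T + 1)\<^sup>2 * (2 * exp (- L))"
    using card by (intro mult_right_mono) auto
  finally show "measure M B \<le> 2 * real k * (real T + 1)\<^sup>2 * exp (- L)" by (simp add: mult_ac)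
qed

text \<open>The concentration events depend only on offsets and placements. Outside their failure
  set, almost every outcome therefore makes the deterministic bound hold for all ways of breaking
  ties at once.\<close>

lemma prob_backlog_le:
  fixes n p k T M :: nat
  assumes n: "1 \<le> n" and p: "1 \<le> p" "p \<le> n" and a: "oblivious_filler p n a"
    and L: "1 \<le> L" and E: "E = real p * (3 + 2 * ln (2 * real n)) + 16 * L"
    and k: "0 < k" "ln (real n) \<le> 2 ^ k" and M: "12 * E \<le> real M"
    and b: "real k + 2 + harm (M + p) + harm p \<le> b"
  shows "1 - 2 * real k * (real T + 1)\<^sup>2 * exp (- L) \<le> measure (random_offsets n)
    {r \<in> space (random_offsets n). \<forall>w. smoothed_greedy_run p n a r w \<longrightarrow>
      (\<forall>t\<ge>1. t \<le> T \<longrightarrow> backlog n (w t) \<le> b)}"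
proof -
  interpret prob_space "random_offsets n" by (rule prob_space_random_offsets)
  define B where "B = (\<Union>(i, s, t) \<in> {..<k} \<times> {(s, t). s \<le> t \<and> t \<le> T}.
    {r \<in> space (random_offsets n). \<not> concentrated n a (level_slack L E n i) L s t r})"
  have "0 \<le> real p * (3 + 2 * ln (2 * real n))" using n by (intro mult_nonneg_nonneg) auto
  then have LE: "16 * L \<le> E" unfolding E by simp
  have B: "B \<in> sets (random_offsets n)" "measure (random_offsets n) B \<le> 2 * real k * (real T + 1)\<^sup>2 * exp (- L)"
    unfolding B_def using prob_all_concentrated[OF n a _ LE, of k T] L by auto
  define G where "G = {r \<in> space (random_offsets n). \<forall>w. smoothed_greedy_run p n a r w \<longrightarrow>
      (\<forall>t\<ge>1. t \<le> T \<longrightarrow> backlog n (w t) \<le> b)}"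
  have "AE r in random_offsets n. r \<in> space (random_offsets n) - B \<longrightarrow> r \<in> G"
    using AE_random_offsets
  proof eventually_elim
    case (elim r)
    show ?case
    proof
      assume r: "r \<in> space (random_offsets n) - B"
      have "backlog n (w t) \<le> b" if run: "smoothed_greedy_run p n a r w" and t: "t \<le> T" for w t
      proof -
        obtain S where "\<And>t. fullest_cups p n (\<lambda>j. w t j + a t j) (S t)"
          and "\<And>t j. j < n \<Longrightarrow> w (Suc t) j =
            (if j \<in> S t \<and> 1 \<le> w t j + a t j then w t j + a t j - 1 else w t j + a t j)"
          using run unfolding smoothed_greedy_run_def smoothed_greedy_move_def by metis
        moreover have w0: "w 0 j = r j" if "j < n" for j
          using run that by (simp add: smoothed_greedy_run_def)
        ultimately interpret greedy_run p n a w S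
          using p a elim by unfold_locales (auto simp: oblivious_filler_def)
        have conc: "concentrated n a (level_slack L E n i) L s u (w 0)"
          if "i < k" "s \<le> u" "u \<le> T" for i s u
        proof -
          have "concentrated n a (level_slack L E n i) L s u r" using r that by (auto simp: B_def)
          then show ?thesis using concentrated_cong[of n r "w 0"] w0 by simp
        qed
        have "w t j \<le> b" if "j < n" for j
          using fill_le_concentrated[OF L refl E conc k M t that] b by simp
        then show ?thesis unfolding backlog_def using n by (subst Max_le_iff) (auto simp: lessThan_empty_iff)
      qed
      then show "r \<in> G" using r by (auto simp: G_def)
    qed
  qed
  moreover have "G \<in> sets (random_offsets n)"
    unfolding G_def using n p by (intro sets_backlog_event) auto
  ultimately have "prob (space (random_offsets n) - B) \<le> prob G" by (rule finite_measure_mono_AE)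
  then show ?thesis using prob_compl[OF B(1)] B(2) by (simp add: G_def)
qed

theorem theorem3p3:
  "\<exists>c0 K :: real. 0 < K \<and>
     (\<forall>c\<ge>c0. \<forall>n p :: nat. \<forall>a :: nat \<Rightarrow> nat \<Rightarrow> real.
        3 \<le> n \<longrightarrow> 1 \<le> p \<longrightarrow> p \<le> n \<longrightarrow> oblivious_filler p n a \<longrightarrow>
        measure (random_offsets n)
          {r \<in> space (random_offsets n).
             \<forall>w. smoothed_greedy_run p n a r w \<longrightarrow>
               (\<forall>t\<ge>1. real t \<le> exp (ln (real n) powr c) \<longrightarrow>
                  backlog n (w t) \<le> K * (ln (real p) + c * ln (ln (real n))))}
        \<ge> 1 - exp (- (ln (real n) powr c)))"
proof -
  define \<kappa> where "\<kappa> = ln (ln (3 :: real))"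
  have \<kappa>: "0 < \<kappa>" using ln_3_gt_1 by (simp add: \<kappa>_def)
  \<comment> \<open>Since \<open>\<kappa> \<le> c * ln (ln n)\<close>, the additive constant
    \<open>6 + ln 6230\<close> becomes a multiple of the claimed bound; the 3 covers the remaining
    logarithmic terms.\<close>
  define K where "K = 3 + (6 + ln 6230) / \<kappa>"
  have K: "0 < K" using \<kappa> by (simp add: K_def add_pos_nonneg)
  show ?thesis
  proof (rule exI[of _ 1], rule exI[of _ K], intro conjI K allI impI)
    fix c :: real and n p :: nat and a :: "nat \<Rightarrow> nat \<Rightarrow> real"
    assume c: "1 \<le> c" and n: "3 \<le> n" and p: "1 \<le> p" "p \<le> n" and a: "oblivious_filler p n a"
    define l where "l = ln (real n)"
    define \<Lambda> where "\<Lambda> = l powr c"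
    define T where "T = nat \<lfloor>exp \<Lambda>\<rfloor>"
    \<comment> \<open>Enough levels for \<open>ln n \<le> 2 ^ k\<close>, and still only
      \<open>O(ln (ln n))\<close> of them up to an additive constant.\<close>
    define k where "k = nat \<lceil>log 2 l\<rceil> + 1"
    \<comment> \<open>The union bound costs at most \<open>8 k exp (2 \<Lambda>)\<close>. With 32
      there remains \<open>k\<close> times \<open>8 exp (- 30 \<Lambda>)\<close>, where
      \<open>exp (29 \<Lambda>)\<close> absorbs \<open>8 k\<close>.\<close>
    define L where "L = 32 * \<Lambda>"
    define E where "E = real p * (3 + 2 * ln (2 * real n)) + 16 * L"
    define M where "M = nat \<lceil>12 * E\<rceil>"
    have l3: "ln 3 \<le> l" using n by (simp add: l_def)
    then have l1: "1 < l" using ln_3_gt_1 by simp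
    have l\<Lambda>: "l \<le> \<Lambda>" unfolding \<Lambda>_def using powr_mono[of 1 c l] c l1 by simp
    then have \<Lambda>1: "1 < \<Lambda>" using l1 by simp
    have ln\<Lambda>: "ln \<Lambda> = c * ln l" using l1 by (simp add: \<Lambda>_def ln_powr)
    have lnl: "0 < ln l" using l1 by simp
    have "\<kappa> \<le> ln l" using l3 l1 ln_3_gt_1 by (simp add: \<kappa>_def)
    also have "\<dots> \<le> c * ln l" using c lnl by (simp add: mult_le_cancel_right1)
    finally have \<kappa>c: "\<kappa> \<le> c * ln l" .

    have "log 2 l \<le> of_int \<lceil>log 2 l\<rceil>" by simp
    also have "\<dots> \<le> real k" by (simp add: k_def)
    finally have "2 powr (log 2 l) \<le> 2 powr (real k)" by simp
    then have k2: "l \<le> 2 ^ k" using l1 by (simp add: powr_realpow)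
    have log0: "0 < log 2 l" using l1 by simp
    then have "real k \<le> log 2 l + 2" unfolding k_def by linarith
    also have "log 2 l = ln l / ln 2" by (simp add: log_def)
    also have "\<dots> \<le> ln l / (2 / 3)" using lnl ln2_ge_two_thirds by (intro divide_left_mono) auto
    finally have k_le: "real k \<le> 2 + 3 / 2 * ln l" by simp
    have "ln l \<le> l - 1" using l1 by (intro ln_le_minus_one) auto
    then have k\<Lambda>: "8 * real k \<le> 29 * \<Lambda>" using k_le l\<Lambda> \<Lambda>1 by linarith

    have "ln (2 * real n) = ln 2 + l" using n by (simp add: l_def ln_mult)
    also have "ln 2 \<le> (1 :: real)" using ln_le_minus_one[of "2 :: real"] by simp
    finally have H: "3 + 2 * ln (2 * real n) \<le> 7 * \<Lambda>" using l\<Lambda> l1 by linarith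
    have "1 * \<Lambda> \<le> real p * \<Lambda>" using p \<Lambda>1 by (intro mult_right_mono) auto
    then have p\<Lambda>: "\<Lambda> \<le> real p * \<Lambda>" by simp
    have "real p * 1 \<le> real p * \<Lambda>" using \<Lambda>1 by (intro mult_left_mono) auto
    then have pp\<Lambda>: "real p \<le> real p * \<Lambda>" by simp
    have "real p * (3 + 2 * ln (2 * real n)) \<le> real p * (7 * \<Lambda>)" using H by (intro mult_left_mono) auto
    then have "E \<le> 519 * (real p * \<Lambda>)" using p\<Lambda> by (simp add: E_def L_def)
    moreover have "0 \<le> E" unfolding E_def L_def using n \<Lambda>1 by (intro add_nonneg_nonneg mult_nonneg_nonneg) auto
    then have M: "12 * E \<le> real M" and "real M \<le> 12 * E + 1" unfolding M_def by linarith+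
    \<comment> \<open>The constants are \<open>519 = 7 + 16 * 32\<close> and
      \<open>6230 = 12 * 519 + 2\<close>; the last 2 pays for rounding \<open>M\<close> up and for
      \<open>p\<close>.\<close>
    ultimately have Mp: "real (M + p) \<le> 6230 * (real p * \<Lambda>)"
      using p\<Lambda> pp\<Lambda> \<Lambda>1 by (simp only: of_nat_add)

    have "harm (M + p) \<le> 1 + ln (real (M + p))" using p by (intro harm_le_ln) auto
    also have "ln (real (M + p)) \<le> ln (6230 * (real p * \<Lambda>))" using Mp p by (intro ln_mono) auto
    also have "\<dots> = ln 6230 + (ln (real p) + c * ln l)"
      using p \<Lambda>1 by (simp add: ln_mult ln\<Lambda>)
    finally have "real k + 2 + harm (M + p) + harm p
        \<le> (6 + ln 6230) + 2 * ln (real p) + (3 / 2 * ln l + c * ln l)"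
      using k_le harm_le_ln[OF p(1)] by linarith
    also have "\<dots> \<le> (6 + ln 6230) + 3 * ln (real p) + 3 * (c * ln l)"
    proof -
      have "1 * ln l \<le> c * ln l" using c lnl by (intro mult_right_mono) auto
      moreover have "0 \<le> ln (real p)" using p by simp
      ultimately show ?thesis using lnl by linarith
    qed
    also have "6 + ln 6230 = (6 + ln 6230) / \<kappa> * \<kappa>" using \<kappa> by simp
    also have "\<dots> \<le> (6 + ln 6230) / \<kappa> * (ln (real p) + c * ln l)"
      using \<kappa> \<kappa>c p by (intro mult_left_mono) (auto intro: add_increasing)
    finally have b: "real k + 2 + harm (M + p) + harm p \<le> K * (ln (real p) + c * ln l)"
      by (simp add: K_def algebra_simps)

    have T_iff: "t \<le> T \<longleftrightarrow> real t \<le> exp \<Lambda>" for t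
      by (simp add: T_def le_nat_iff le_floor_iff)
    have k_exp: "8 * real k \<le> exp (29 * \<Lambda>)"
      using k\<Lambda> exp_ge_add_one_self[of "29 * \<Lambda>"] by linarith
    have "real T \<le> exp \<Lambda>" using T_iff[of T] by simp
    then have "real T + 1 \<le> 2 * exp \<Lambda>" using \<Lambda>1 by (smt (verit) one_le_exp_iff)
    then have "(real T + 1)\<^sup>2 \<le> (2 * exp \<Lambda>)\<^sup>2" by (intro power_mono) auto
    then have "2 * real k * (real T + 1)\<^sup>2 * exp (- L) \<le> 2 * real k * (2 * exp \<Lambda>)\<^sup>2 * exp (- L)"
      by (intro mult_right_mono mult_left_mono) auto
    also have "\<dots> = 8 * real k * (exp \<Lambda> * exp \<Lambda> * exp (- L))" by (simp add: power2_eq_square)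
    also have "exp \<Lambda> * exp \<Lambda> * exp (- L) = exp (- (30 * \<Lambda>))"
      by (simp add: L_def flip: exp_add)
    also have "8 * real k * exp (- (30 * \<Lambda>)) \<le> exp (29 * \<Lambda>) * exp (- (30 * \<Lambda>))"
      using k_exp by (rule mult_right_mono) simp
    also have "\<dots> = exp (- \<Lambda>)" by (simp flip: exp_add)
    finally have fail: "2 * real k * (real T + 1)\<^sup>2 * exp (- L) \<le> exp (- \<Lambda>)" .

    have "1 - 2 * real k * (real T + 1)\<^sup>2 * exp (- L) \<le> measure (random_offsets n)
      {r \<in> space (random_offsets n). \<forall>w. smoothed_greedy_run p n a r w \<longrightarrow>
        (\<forall>t\<ge>1. t \<le> T \<longrightarrow> backlog n (w t) \<le> K * (ln (real p) + c * ln l))}"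
      by (rule prob_backlog_le[OF _ p a _ E_def _ _ M b])
        (use n \<Lambda>1 k2 in \<open>auto simp: L_def k_def l_def\<close>)
    then show "1 - exp (- (ln (real n) powr c)) \<le> measure (random_offsets n)
      {r \<in> space (random_offsets n). \<forall>w. smoothed_greedy_run p n a r w \<longrightarrow>
        (\<forall>t\<ge>1. real t \<le> exp (ln (real n) powr c) \<longrightarrow>
          backlog n (w t) \<le> K * (ln (real p) + c * ln (ln (real n))))}"
      using fail unfolding T_iff by (simp add: \<Lambda>_def l_def)
  qed
qed

end
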